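(* For every $n\ge 2$, the structure group of the theory $SC_n$ of symmetric $n$-Catalan algebras is isomorphic to the Higman–Thompson group $G_{n,1}$: $\mathrm{Struct}_G(SC_n)\cong G_{n,1}$.
   Context: Composition: $f\cdot g$ means "$f$ followed by $g$". For integers $i\le j$, $x_i^j$ denotes the list $x_i,x_{i+1},\dots,x_j$; if $i>j$ it is the empty list. **Theory $SC_n$.** $\mathcal{V}$ is a set of variables, there is a single $n$-ary function symbol $\otimes$, and $\mathbb{F}_\otimes(\mathcal{V})$ is the absolutely free term algebra. The equations of $SC_n$ are, for $0<i<n$, $$\otimes(x_1^i,\otimes(x_{i+1}^{i+n}),x_{i+n+1}^{2n-1})=\otimes(x_1^{i-1},\otimes(x_i^{i+n-1}),x_{i+n}^{2n-1}),$$ together with, for $1\le i<n$, $$\otimes(x_1^{i-1},x_i,x_{i+1},x_{i+2}^n)=\otimes(x_1^{i-1},x_{i+1},x_i,x_{i+2}^n).$$ **Structure group.** A substitution is a map $\varphi:\mathcal{V}\to\mathbb{F}_\otimes(\mathcal{V})$, extended to an endomorphism $s\mapsto s^\varphi$ of the term algebra. For an equation $s=t$ or its reverse, $\rho_{s,t}$ is the partial function on $\mathbb{F}_\otimes(\mathcal{V})$ with graph $\{(s^\varphi,t^\varphi)\mid\varphi\text{ a substitution}\}$. An address is a word $\alpha$ in $\{1,\dots,n\}$, specifying the path from the root of a term tree to a subterm; $\rho_{s,t}^\alpha$ is the partial function defined on terms $u$ that have a subterm at $\alpha$ lying in the domain of $\rho_{s,t}$, and it replaces that subterm by its image under $\rho_{s,t}$,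 leaving the rest of $u$ unchanged. $\mathrm{Struct}(SC_n)$ is the monoid of partial maps generated under composition by all $\rho_{s,t}^\alpha$ with $(s,t)$ or $(t,s)$ an equation of $SC_n$ and $\alpha$ an address; it is an inverse monoid. $\mathrm{Struct}_G(SC_n)$ is its universal group, obtained by collapsing all idempotents to $1$. **The group $G_{n,1}$.** An $n$-ary tree is either a single vertex or a root with an ordered list of $n$ subtrees that are $n$-ary trees; $\ell(T)$ is the set of leaves of $T$. A simple expansion of a tree replaces one leaf $v$ by a vertex with $n$ ordered leaf children $\alpha_1(v),\dots,\alpha_n(v)$. An $n$-ary tree diagram is a triple $(T_1,T_2,\sigma)$ with $T_1,T_2$ $n$-ary trees with the same number of leaves and $\sigma:\ell(T_1)\to\ell(T_2)$ a bijection. A simple expansion of $(T_1,T_2,\sigma)$ is $(T_1',T_2',\sigma')$ where $T_1'$ is the simple expansion of $T_1$ at a leaf $l$, $T_2'$ is the simple expansion of $T_2$ at $\sigma(l)$, $\sigma'=\sigma$ on $\ell(T_1)\setminus\{l\}$ and $\sigma'(\alpha_i(l))=\alpha_i(\sigma(l))$. An expansion is the result of finitely many successive simple expansions. Two tree diagrams are equivalent if they have a common expansion; the equivalence class $[(T_1,T_2,\sigma)]$ is an $n$-ary tree symbol. $G_{n,1}$ is the group of $n$-ary tree symbols with product $[(T_1,T,\sigma)][(T,T_2,\sigma')]=[(T_1,T_2,\sigma\cdot\sigma')]$ (representatives can always be chosen with matching middle tree), inverse $[(T_1,T_2,\sigma)]^{-1}=[(T_2,T_1,\sigma^{-1})]$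 and unit $[(T,T,\mathrm{id})]$. *)

theory Defs
  imports "HOL-Algebra.Algebra"
begin

section \<open>The theory SC(n) and its structure group\<close>

datatype 'v trm = Var 'v | Op "'v trm list"

text \<open>The absolutely free algebra on the variables \<open>'v\<close> for one \<open>n\<close>-ary symbol: the
  raw terms all of whose \<open>Op\<close>-nodes have exactly \<open>n\<close> arguments.\<close>

inductive_set trms :: "nat \<Rightarrow> 'v trm set" for n :: nat where
  Var: "Var v \<in> trms n"
| Op: "\<lbrakk>length us = n; \<And>u. u \<in> set us \<Longrightarrow> u \<in> trms n\<rbrakk> \<Longrightarrow> Op us \<in> trms n"

primrec subst_trm :: "('v \<Rightarrow> 'v trm) \<Rightarrow> 'v trm \<Rightarrow> 'v trm" where
  "subst_trm \<phi> (Var v) = \<phi> v"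
| "subst_trm \<phi> (Op us) = Op (map (subst_trm \<phi>) us)"

text \<open>\<open>vars x i j\<close> is the list \<open>x\<^sub>i, \<dots>, x\<^sub>j\<close>, which is empty for \<open>i > j\<close>.\<close>

definition vars :: "(nat \<Rightarrow> 'v) \<Rightarrow> nat \<Rightarrow> nat \<Rightarrow> 'v trm list" where
  "vars x i j = map (\<lambda>k. Var (x k)) [i..<Suc j]"

text \<open>The equations are written in the variables \<open>x 1, \<dots>, x (2 * n - 1)\<close>, which are
  meant to be pairwise distinct; injectivity of \<open>x\<close> on \<open>{1..2 * n - 1}\<close> is a
  hypothesis wherever it is needed.\<close>

definition SC_equations :: "nat \<Rightarrow> (nat \<Rightarrow> 'v) \<Rightarrow> ('v trm \<times> 'v trm) set" where
  "SC_equations n x =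
     {(Op (vars x 1 i @ [Op (vars x (i + 1) (i + n))] @ vars x (i + n + 1) (2 * n - 1)),
       Op (vars x 1 (i - 1) @ [Op (vars x i (i + n - 1))] @ vars x (i + n) (2 * n - 1)))
      | i. 0 < i \<and> i < n} \<union>
     {(Op (vars x 1 (i - 1) @ [Var (x i), Var (x (i + 1))] @ vars x (i + 2) n),
       Op (vars x 1 (i - 1) @ [Var (x (i + 1)), Var (x i)] @ vars x (i + 2) n))
      | i. 1 \<le> i \<and> i < n}"

text \<open>Partial maps on terms are represented by their graphs, so that \<open>f O g\<close> is
  ``\<open>f\<close> followed by \<open>g\<close>''.\<close>

definition rho :: "nat \<Rightarrow> 'v trm \<Rightarrow> 'v trm \<Rightarrow> ('v trm \<times> 'v trm) set" where
  "rho n s t = {(subst_trm \<phi> s, subst_trm \<phi> t) | \<phi>. \<forall>v. \<phi> v \<in> trms n}"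

text \<open>Addresses are words in \<open>{1..n}\<close>; the letter \<open>i\<close> leads to the argument with list
  index \<open>i - 1\<close>.\<close>

fun subterm_at :: "nat list \<Rightarrow> 'v trm \<Rightarrow> 'v trm option" where
  "subterm_at [] u = Some u"
| "subterm_at (i # \<alpha>) (Var v) = None"
| "subterm_at (i # \<alpha>) (Op us) =
     (if 1 \<le> i \<and> i \<le> length us then subterm_at \<alpha> (us ! (i - 1)) else None)"

text \<open>Only relevant when \<open>subterm_at \<alpha> u \<noteq> None\<close>.\<close>

fun replace_at :: "nat list \<Rightarrow> 'v trm \<Rightarrow> 'v trm \<Rightarrow> 'v trm" where
  "replace_at [] u w = w"
| "replace_at (i # \<alpha>) (Var v) w = Var v"
| "replace_at (i # \<alpha>) (Op us) w = Op (us[i - 1 := replace_at \<alpha> (us ! (i - 1)) w])"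

definition rho_at ::
  "nat \<Rightarrow> 'v trm \<Rightarrow> 'v trm \<Rightarrow> nat list \<Rightarrow> ('v trm \<times> 'v trm) set" where
  "rho_at n s t \<alpha> =
     {(u, replace_at \<alpha> u w') | u w w'.
        u \<in> trms n \<and> subterm_at \<alpha> u = Some w \<and> (w, w') \<in> rho n s t}"

inductive_set Struct_carrier :: "nat \<Rightarrow> (nat \<Rightarrow> 'v) \<Rightarrow> ('v trm \<times> 'v trm) set set"
  for n :: nat and x :: "nat \<Rightarrow> 'v" where
  ident: "Id_on (trms n) \<in> Struct_carrier n x"
| gen: "\<lbrakk>(s, t) \<in> SC_equations n x \<or> (t, s) \<in> SC_equations n x; set \<alpha> \<subseteq> {1..n}\<rbrakk>
    \<Longrightarrow> rho_at n s t \<alpha> \<in> Struct_carrier n x"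
| comp: "\<lbrakk>f \<in> Struct_carrier n x; g \<in> Struct_carrier n x\<rbrakk> \<Longrightarrow> f O g \<in> Struct_carrier n x"

definition Struct :: "nat \<Rightarrow> (nat \<Rightarrow> 'v) \<Rightarrow> ('v trm \<times> 'v trm) set monoid" where
  "Struct n x = \<lparr>carrier = Struct_carrier n x, monoid.mult = (O), one = Id_on (trms n)\<rparr>"

text \<open>The least congruence on a monoid that identifies every idempotent with the unit.\<close>

inductive_set idem_cong :: "('a, 'b) monoid_scheme \<Rightarrow> ('a \<times> 'a) set"
  for M :: "('a, 'b) monoid_scheme" (structure) where
  idem: "\<lbrakk>e \<in> carrier M; e \<otimes> e = e\<rbrakk> \<Longrightarrow> (e, \<one>) \<in> idem_cong M"
| refl: "a \<in> carrier M \<Longrightarrow> (a, a) \<in> idem_cong M"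
| sym: "(a, b) \<in> idem_cong M \<Longrightarrow> (b, a) \<in> idem_cong M"
| trans: "\<lbrakk>(a, b) \<in> idem_cong M; (b, c) \<in> idem_cong M\<rbrakk> \<Longrightarrow> (a, c) \<in> idem_cong M"
| mult: "\<lbrakk>(a, b) \<in> idem_cong M; (c, d) \<in> idem_cong M\<rbrakk> \<Longrightarrow> (a \<otimes> c, b \<otimes> d) \<in> idem_cong M"

text \<open>The union in the product is over representatives; as \<open>idem_cong M\<close> is a
  congruence on a monoid \<open>M\<close>, all the classes in it coincide.\<close>

definition universal_group :: "('a, 'b) monoid_scheme \<Rightarrow> 'a set monoid" where
  "universal_group M =
     \<lparr>carrier = carrier M // idem_cong M,
      monoid.mult = (\<lambda>A B. \<Union>a\<in>A. \<Union>b\<in>B. idem_cong M `` {a \<otimes>\<^bsub>M\<^esub> b}),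
      one = idem_cong M `` {\<one>\<^bsub>M\<^esub>}\<rparr>"

definition Struct_G :: "nat \<Rightarrow> (nat \<Rightarrow> 'v) \<Rightarrow> ('v trm \<times> 'v trm) set set monoid" where
  "Struct_G n x = universal_group (Struct n x)"


section \<open>The Higman--Thompson group\<close>

datatype tree = Leaf | Node "tree list"

inductive_set nary_trees :: "nat \<Rightarrow> tree set" for n :: nat where
  Leaf: "Leaf \<in> nary_trees n"
| Node: "\<lbrakk>length ts = n; \<And>t. t \<in> set ts \<Longrightarrow> t \<in> nary_trees n\<rbrakk> \<Longrightarrow> Node ts \<in> nary_trees n"

text \<open>A leaf is identified with its address, a word in \<open>{1..n}\<close>; hence the \<open>i\<close>-th child
  \<open>\<alpha>\<^sub>i(v)\<close> of \<open>v\<close> is \<open>v @ [i]\<close>.\<close>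

primrec leaves :: "tree \<Rightarrow> nat list set" where
  "leaves Leaf = {[]}"
| "leaves (Node ts) = (\<Union>i\<in>{1..length ts}. (#) i ` (map leaves ts ! (i - 1)))"

text \<open>\<open>expand_at n l T\<close> is the simple expansion of \<open>T\<close> at \<open>l\<close>; it is only relevant for
  \<open>l \<in> leaves T\<close>.\<close>

fun expand_at :: "nat \<Rightarrow> nat list \<Rightarrow> tree \<Rightarrow> tree" where
  "expand_at n [] T = Node (replicate n Leaf)"
| "expand_at n (i # l) Leaf = Leaf"
| "expand_at n (i # l) (Node ts) = Node (ts[i - 1 := expand_at n l (ts ! (i - 1))])"

type_synonym diagram = "tree \<times> tree \<times> (nat list \<Rightarrow> nat list)"

text \<open>Extensionality makes \<open>\<sigma>\<close> a map on \<open>leaves T1\<close> only, with no information in its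
  values elsewhere.\<close>

definition tree_diagrams :: "nat \<Rightarrow> diagram set" where
  "tree_diagrams n =
     {(T1, T2, \<sigma>). T1 \<in> nary_trees n \<and> T2 \<in> nary_trees n \<and>
        card (leaves T1) = card (leaves T2) \<and>
        \<sigma> \<in> extensional (leaves T1) \<and> bij_betw \<sigma> (leaves T1) (leaves T2)}"

definition simple_expansion :: "nat \<Rightarrow> (diagram \<times> diagram) set" where
  "simple_expansion n =
     {((T1, T2, \<sigma>), (T1', T2', \<sigma>')) | T1 T2 \<sigma> T1' T2' \<sigma>'.
        (T1, T2, \<sigma>) \<in> tree_diagrams n \<and> (T1', T2', \<sigma>') \<in> tree_diagrams n \<and>
        (\<exists>l \<in> leaves T1.
           T1' = expand_at n l T1 \<and> T2' = expand_at n (\<sigma> l) T2 \<and>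
           (\<forall>v \<in> leaves T1 - {l}. \<sigma>' v = \<sigma> v) \<and>
           (\<forall>i \<in> {1..n}. \<sigma>' (l @ [i]) = \<sigma> l @ [i]))}"

definition diagram_equiv :: "nat \<Rightarrow> (diagram \<times> diagram) set" where
  "diagram_equiv n =
     {(d, d'). d \<in> tree_diagrams n \<and> d' \<in> tree_diagrams n \<and>
        (\<exists>e. (d, e) \<in> (simple_expansion n)\<^sup>* \<and> (d', e) \<in> (simple_expansion n)\<^sup>*)}"

text \<open>In the product, the union is over all pairs of representatives with matching middle
  tree; they all yield the same class. Note that \<open>compose A g f\<close> is \<open>f\<close> followed by \<open>g\<close> on
  \<open>A\<close>. The unit is the common class of all \<open>(T, T, id)\<close>, represented by \<open>T = Leaf\<close>.\<close>

definition Higman_Thompson :: "nat \<Rightarrow> diagram set monoid" where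
  "Higman_Thompson n =
     \<lparr>carrier = tree_diagrams n // diagram_equiv n,
      monoid.mult = (\<lambda>A B. \<Union>{diagram_equiv n `` {(T1, T2, compose (leaves T1) \<sigma>' \<sigma>)}
                        | T1 T T2 \<sigma> \<sigma>'. (T1, T, \<sigma>) \<in> A \<and> (T, T2, \<sigma>') \<in> B}),
      one = diagram_equiv n `` {(Leaf, Leaf, \<lambda>v\<in>leaves Leaf. v)}\<rparr>"

end

theory Submission
  imports Defs "HOL-Library.Stream" "HOL-Combinatorics.Permutations"
begin

text \<open>
  Both groups are identified with one group of permutations of the space of ends, the
  infinite words over \<open>{1..n}\<close>. A generator \<open>\<rho>\<close> at address \<open>\<alpha>\<close> of the structure monoid moves the
  subterms sitting at the variables of its equation, hence induces a permutation of the ends that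
  replaces finite prefixes. If a partial map \<open>f\<close> in the monoid induces \<open>g\<close>, then for
  \<open>(u, v) \<in> f\<close> every leaf of \<open>u\<close> reappears in \<open>v\<close> at the address given by \<open>g\<close>; moreover \<open>f\<close> is
  defined on all sufficiently deep terms. So \<open>g\<close> is the identity if and only if \<open>f\<close> is idempotent, and
  the universal group is the group of the induced permutations.

  A tree diagram also acts on the ends by replacing prefixes, and two diagrams are equivalent if
  and only if they act in the same way, since both can be expanded to the same complete source tree.
  Symmetry gives the exchange of two sibling cones, associativity conjugates it to an exchange of a
  cone with a child of its sibling, and iterating gives all exchanges of two disjoint cones. These
  generate the action of every diagram.
\<close>

text \<open>Multiplying partial maps or diagrams means passing to common refinements; permutations
  of the infinite words compose without any choice. The delicate direction is back from a partial
  map to its permutation, because domains shrink under composition and one map is given by many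
  words. Two features of the equations save it. Each variable occurs exactly once on either side, so
  subterms are neither copied nor erased and the induced map of ends is bijective. And the domain of
  every word contains all sufficiently deep terms, so no composite is empty and complete terms can
  be used as probes, with two distinct variables as labels. The bound \<open>n \<ge> 2\<close> makes
  a cone determine its word: over one letter there is a single end, which has all words as prefixes.
  It also provides the spare sibling that is used to lengthen an exchange by one letter, and it
  makes contracting siblings decrease the size of a code.\<close>

section \<open>Permutations of a set as relations\<close>

definition bij_rel :: "'a set \<Rightarrow> ('a \<times> 'a) set \<Rightarrow> bool" where
  "bij_rel A g \<longleftrightarrow> g \<subseteq> A \<times> A \<and> g O g\<inverse> = Id_on A \<and> g\<inverse> O g = Id_on A"

lemma bij_relI:
  assumes "g \<subseteq> A \<times> A" "\<And>a. a \<in> A \<Longrightarrow> \<exists>b. (a, b) \<in> g" "\<And>b. b \<in> A \<Longrightarrow> \<exists>a. (a, b) \<in> g"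
    and "\<And>a b c. (a, b) \<in> g \<Longrightarrow> (a, c) \<in> g \<Longrightarrow> b = c"
    and "\<And>a b c. (a, c) \<in> g \<Longrightarrow> (b, c) \<in> g \<Longrightarrow> a = b"
  shows "bij_rel A g"
  unfolding bij_rel_def
proof (intro conjI equalityI subsetI)
  fix z assume "z \<in> g O g\<inverse>" then show "z \<in> Id_on A" using assms(1,5) by fastforce
next
  fix z assume "z \<in> Id_on A" then show "z \<in> g O g\<inverse>" using assms(2) by fastforce
next
  fix z assume "z \<in> g\<inverse> O g" then show "z \<in> Id_on A" using assms(1,4) by fastforce
next
  fix z assume "z \<in> Id_on A" then show "z \<in> g\<inverse> O g" using assms(3) by fastforce
next
  fix z assume "z \<in> g" then show "z \<in> A \<times> A" using assms(1) by blast
qed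

lemma bij_rel_subset: "bij_rel A g \<Longrightarrow> (a, b) \<in> g \<Longrightarrow> a \<in> A \<and> b \<in> A"
  unfolding bij_rel_def by blast

lemma bij_rel_total: "bij_rel A g \<Longrightarrow> a \<in> A \<Longrightarrow> \<exists>b. (a, b) \<in> g"
  unfolding bij_rel_def by blast

lemma bij_rel_surj: "bij_rel A g \<Longrightarrow> b \<in> A \<Longrightarrow> \<exists>a. (a, b) \<in> g"
  unfolding bij_rel_def by blast

lemma bij_rel_functional:
  assumes "bij_rel A g" "(a, b) \<in> g" "(a, c) \<in> g"
  shows "b = c"
proof -
  have "(b, c) \<in> g\<inverse> O g" using assms(2,3) by blast
  then show ?thesis using assms(1) by (auto simp: bij_rel_def)
qed

lemma bij_rel_inj:
  assumes "bij_rel A g" "(a, c) \<in> g" "(b, c) \<in> g"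
  shows "a = b"
proof -
  have "(a, b) \<in> g O g\<inverse>" using assms(2,3) by blast
  then show ?thesis using assms(1) by (auto simp: bij_rel_def)
qed

lemma bij_rel_Id_on: "bij_rel A (Id_on A)"
  by (rule bij_relI) auto

lemma bij_rel_converse: "bij_rel A g \<Longrightarrow> bij_rel A (g\<inverse>)"
  unfolding bij_rel_def by auto

lemma bij_rel_comp:
  assumes "bij_rel A g" "bij_rel A h"
  shows "bij_rel A (g O h)"
proof (rule bij_relI)
  show "g O h \<subseteq> A \<times> A" using assms bij_rel_subset by fast
  show "\<exists>b. (a, b) \<in> g O h" if "a \<in> A" for a
    using that assms bij_rel_total bij_rel_subset by (metis relcompI)
  show "\<exists>a. (a, b) \<in> g O h" if "b \<in> A" for b
    using that assms bij_rel_surj bij_rel_subset by (metis relcompI)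
  show "b = c" if "(a, b) \<in> g O h" "(a, c) \<in> g O h" for a b c
    using that assms bij_rel_functional by (metis relcompEpair)
  show "a = b" if "(a, c) \<in> g O h" "(b, c) \<in> g O h" for a b c
    using that assms bij_rel_inj by (metis relcompEpair)
qed

lemma bij_rel_comp_converse: "bij_rel A g \<Longrightarrow> g O g\<inverse> = Id_on A"
  and bij_rel_converse_comp: "bij_rel A g \<Longrightarrow> g\<inverse> O g = Id_on A"
  by (simp_all add: bij_rel_def)

lemma bij_rel_comp_Id_on:
  assumes "bij_rel A g"
  shows "g O Id_on A = g" "Id_on A O g = g"
  using assms unfolding bij_rel_def by auto

text \<open>A bijection of \<open>A\<close> has no proper extension to a bijection of
  \<open>A\<close>, so one inclusion gives equality. Most identities between permutations below are
  proved by checking that the defining pairs of one lie in the other.\<close>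

lemma bij_rel_eqI:
  assumes "bij_rel A g" "bij_rel A h" "g \<subseteq> h"
  shows "g = h"
proof
  show "h \<subseteq> g"
  proof (rule subrelI)
    fix a b assume ab: "(a, b) \<in> h"
    then obtain c where "(a, c) \<in> g" using assms bij_rel_subset bij_rel_total by metis
    then show "(a, b) \<in> g" using assms ab bij_rel_functional by (metis subsetD)
  qed
qed (fact assms(3))

section \<open>Ends, cones and prefix replacement\<close>

abbreviation ends :: "nat \<Rightarrow> nat stream set" where
  "ends n \<equiv> streams {1..n}"

definition maps_cone :: "nat \<Rightarrow> (nat stream \<times> nat stream) set \<Rightarrow> nat list \<Rightarrow> nat list \<Rightarrow> bool" where
  "maps_cone n g p q \<longleftrightarrow> (\<forall>w\<in>ends n. (p @- w, q @- w) \<in> g)"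

lemma shift_in_streams [simp]: "p @- w \<in> streams A \<longleftrightarrow> p \<in> lists A \<and> w \<in> streams A"
  by (auto simp: streams_iff_sset)

lemma sconst_in_ends: "k \<in> {1..n} \<Longrightarrow> sconst k \<in> ends n"
  by (simp add: streams_iff_sset)

text \<open>After cancelling a common beginning, one of the words is empty. The other then cannot
  have a first letter, because that letter would begin every end, both \<open>sconst 1\<close> and
  \<open>sconst 2\<close>.\<close>

lemma cone_eqD:
  assumes "n \<ge> 2" "\<And>w. w \<in> ends n \<Longrightarrow> p @- w = q @- w"
  shows "p = q"
  using assms(2)
proof (induction p arbitrary: q)
  case Nil
  show ?case
  proof (cases q)
    case (Cons a q')
    have "a = 1" "a = 2"
      using Nil[of "sconst 1"] Nil[of "sconst 2"] assms(1) Cons sconst_in_ends[of 1 n] sconst_in_ends[of 2 n]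
      by (metis (no_types) atLeastAtMost_iff order.trans one_le_numeral order_refl shift.simps siterate.simps(1) stream.sel(1))+
    then show ?thesis by simp
  qed simp
next
  case (Cons a p)
  show ?case
  proof (cases q)
    case Nil
    have "a = 1" "a = 2"
      using Cons.prems[of "sconst 1"] Cons.prems[of "sconst 2"] assms(1) Nil sconst_in_ends[of 1 n] sconst_in_ends[of 2 n]
      by (metis (no_types) atLeastAtMost_iff order.trans one_le_numeral order_refl shift.simps siterate.simps(1) stream.sel(1))+
    then show ?thesis by simp
  next
    case (Cons b q')
    then show ?thesis using Cons.IH[of q'] Cons.prems sconst_in_ends[of 1 n] assms(1) by fastforce
  qed
qed

lemma maps_cone_unique:
  assumes "n \<ge> 2" "bij_rel (ends n) g" "maps_cone n g p q" "maps_cone n g p q'"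
  shows "q = q'"
proof (rule cone_eqD[OF assms(1)])
  show "q @- w = q' @- w" if "w \<in> ends n" for w
    using assms(3,4) that bij_rel_functional[OF assms(2)] unfolding maps_cone_def by blast
qed

lemma maps_cone_comp: "maps_cone n g p q \<Longrightarrow> maps_cone n h q r \<Longrightarrow> maps_cone n (g O h) p r"
  by (auto simp: maps_cone_def)

lemma shift_same_length: "p @- w = q @- z \<Longrightarrow> length p = length q \<Longrightarrow> p = q \<and> w = z"
proof (induction p arbitrary: q)
  case (Cons a p)
  then show ?case by (cases q) auto
qed simp

subsection \<open>Terms\<close>

lemma subterm_at_append:
  "subterm_at (p @ q) u = (case subterm_at p u of None \<Rightarrow> None | Some u' \<Rightarrow> subterm_at q u')"
  by (induction p u rule: subterm_at.induct) auto

lemma subterm_at_trms: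
  "subterm_at p u = Some w \<Longrightarrow> u \<in> trms n \<Longrightarrow> w \<in> trms n \<and> p \<in> lists {1..n}"
proof (induction p u rule: subterm_at.induct)
  case (3 i \<alpha> us)
  from 3(3) have "length us = n" "\<And>u. u \<in> set us \<Longrightarrow> u \<in> trms n" by (auto elim: trms.cases)
  then show ?case using 3 by (auto split: if_splits)
qed simp_all

lemma subterm_at_Op_iff:
  "subterm_at p (Op us) = Some (Var v) \<longleftrightarrow>
     (\<exists>i q. p = Suc i # q \<and> i < length us \<and> subterm_at q (us ! i) = Some (Var v))"
  by (cases p) (auto simp: Suc_le_eq gr0_conv_Suc)

text \<open>If two addresses begin the same stream, one is a prefix of the other, and nothing lies
  strictly below a variable.\<close>

lemma leaf_prefix_free:
  "subterm_at p u = Some (Var v) \<Longrightarrow> subterm_at q u = Some (Var v') \<Longrightarrow> p @- w = q @- w' \<Longrightarrow> p = q"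
proof (induction p arbitrary: u q)
  case Nil
  then show ?case by (cases q) auto
next
  case (Cons i p)
  then show ?case by (cases u; cases q) (auto split: if_splits)
qed

text \<open>The end \<open>z\<close> is a path that descends in \<open>u\<close>; every node has an
  argument for each of the \<open>n\<close> letters, so the path stops only at a variable.\<close>

lemma leaf_cover:
  assumes "u \<in> trms n" "z \<in> ends n"
  shows "\<exists>p v w. subterm_at p u = Some (Var v) \<and> w \<in> ends n \<and> z = p @- w"
  using assms
proof (induction arbitrary: z)
  case (Var v)
  then show ?case by (metis shift.simps(1) subterm_at.simps(1))
next
  case (Op us)
  obtain i z' where z: "z = Suc i ## z'" "z' \<in> ends n" "i < n"
    using Op.prems by (cases z; cases "shd z") auto
  then obtain p v w where "subterm_at p (us ! i) = Some (Var v)" "w \<in> ends n" "z' = p @- w"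
    using Op.IH Op.hyps nth_mem by metis
  then show ?case using z Op.hyps by (intro exI[of _ "Suc i # p"] exI[of _ v] exI[of _ w]) auto
qed

section \<open>Linear terms and substitution\<close>

text \<open>A list rather than a set, so that \<open>distinct (vlist u)\<close> expresses linearity
  of \<open>u\<close>.\<close>

primrec vlist :: "'v trm \<Rightarrow> 'v list" where
  "vlist (Var v) = [v]"
| "vlist (Op us) = concat (map vlist us)"

lemma set_vlist: "v \<in> set (vlist u) \<longleftrightarrow> (\<exists>p. subterm_at p u = Some (Var v))"
proof (induction u)
  case (Var y)
  show ?case by (auto intro: exI[of _ "[]"] elim: subterm_at.elims)
next
  case (Op us)
  have "v \<in> set (vlist (Op us)) \<longleftrightarrow> (\<exists>i<length us. v \<in> set (vlist (us ! i)))"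
    by (auto simp: set_conv_nth[of us])
  also have "\<dots> \<longleftrightarrow> (\<exists>i<length us. \<exists>q. subterm_at q (us ! i) = Some (Var v))"
    using Op nth_mem by blast
  finally show ?case unfolding subterm_at_Op_iff by blast
qed

lemma distinct_concat_index:
  "distinct (concat xss) \<Longrightarrow> i < length xss \<Longrightarrow> j < length xss \<Longrightarrow> a \<in> set (xss ! i) \<Longrightarrow> a \<in> set (xss ! j) \<Longrightarrow> i = j"
proof (induction xss arbitrary: i j)
  case (Cons xs xss)
  then show ?case by (cases i; cases j) (auto dest!: nth_mem)
qed simp

lemma linear_leaf_unique:
  "distinct (vlist u) \<Longrightarrow> subterm_at p u = Some (Var v) \<Longrightarrow> subterm_at q u = Some (Var v) \<Longrightarrow> p = q"
proof (induction u arbitrary: p q)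
  case (Var y)
  then show ?case by (auto elim!: subterm_at.elims)
next
  case (Op us)
  obtain i p' j q' where pq: "p = Suc i # p'" "i < length us" "subterm_at p' (us ! i) = Some (Var v)"
    "q = Suc j # q'" "j < length us" "subterm_at q' (us ! j) = Some (Var v)"
    using Op.prems by (auto simp only: subterm_at_Op_iff)
  then have "v \<in> set (vlist (us ! i))" "v \<in> set (vlist (us ! j))" by (auto simp: set_vlist)
  then have "i = j" using distinct_concat_index[of "map vlist us" i j v] Op.prems pq by auto
  moreover have "distinct (vlist (us ! i))" using Op.prems pq by (auto simp: distinct_concat_iff)
  ultimately show ?case using Op.IH pq nth_mem by blast
qed

lemma subterm_at_subst:
  "subterm_at p s = Some (Var v) \<Longrightarrow> subterm_at (p @ q) (subst_trm \<phi> s) = subterm_at q (\<phi> v)"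
  by (induction p s rule: subterm_at.induct) (auto split: if_splits)

lemma leaf_of_subst:
  "subterm_at p (subst_trm \<phi> s) = Some (Var y) \<Longrightarrow>
    \<exists>p1 p2 v. p = p1 @ p2 \<and> subterm_at p1 s = Some (Var v) \<and> subterm_at p2 (\<phi> v) = Some (Var y)"
proof (induction s arbitrary: p)
  case (Var v)
  then have "p = [] @ p \<and> subterm_at [] (Var v) = Some (Var v) \<and> subterm_at p (\<phi> v) = Some (Var y)"
    by simp
  then show ?case by blast
next
  case (Op us)
  then obtain i q where "p = Suc i # q" "i < length us" "subterm_at q (subst_trm \<phi> (us ! i)) = Some (Var y)"
    by (auto simp: subterm_at_Op_iff)
  then show ?case using Op.IH[of "us ! i" q]
    by (metis append_Cons nth_mem subterm_at_Op_iff)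
qed

lemma subst_trms:
  "s \<in> trms n \<Longrightarrow> (\<And>v. \<phi> v \<in> trms n) \<Longrightarrow> subst_trm \<phi> s \<in> trms n"
  by (induction rule: trms.induct) (auto intro!: trms.Op)

lemma leaf_exists: "u \<in> trms n \<Longrightarrow> n > 0 \<Longrightarrow> \<exists>p v. subterm_at p u = Some (Var v)"
  using leaf_cover[of u n "sconst 1"] sconst_in_ends[of 1 n] by auto

text \<open>The leaves of \<open>s\<close> suffice because \<open>n > 0\<close> gives every term a
  leaf: below an \<open>Op\<close> of \<open>s\<close> some longer address is then defined in
  \<open>u\<close>, which must have an \<open>Op\<close> there too.\<close>

lemma subst_eqI:
  assumes "s \<in> trms n" "u \<in> trms n" "n > 0"
    and "\<And>p v. subterm_at p s = Some (Var v) \<Longrightarrow> subterm_at p u = Some (\<phi> v)"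
  shows "subst_trm \<phi> s = u"
  using assms(1,2,4)
proof (induction arbitrary: u)
  case (Var v)
  then show ?case using Var.prems(2)[of "[]" v] by simp
next
  case (Op ss)
  obtain p v where "subterm_at p (ss ! 0) = Some (Var v)"
    using leaf_exists Op.hyps assms(3) nth_mem by metis
  then have "subterm_at (Suc 0 # p) u \<noteq> None"
    using Op.prems(2)[of "Suc 0 # p" v] Op.hyps assms(3) by auto
  then obtain us where u: "u = Op us" by (cases u) auto
  then have us: "length us = n" "\<And>u. u \<in> set us \<Longrightarrow> u \<in> trms n"
    using Op.prems(1) by (auto elim: trms.cases)
  have "subst_trm \<phi> (ss ! i) = us ! i" if i: "i < n" for i
  proof (rule Op.IH)
    show "ss ! i \<in> set ss" "us ! i \<in> trms n" using i Op.hyps us by auto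
    show "subterm_at p (us ! i) = Some (\<phi> v)" if "subterm_at p (ss ! i) = Some (Var v)" for p v
      using Op.prems(2)[of "Suc i # p" v] that i u us Op.hyps by auto
  qed
  then show ?case using u us Op.hyps by (auto intro: nth_equalityI)
qed

text \<open>With \<open>Var\<close> as the substitution, \<open>subst_eqI\<close> recognises both
  \<open>u\<close> and \<open>v\<close> as the same instance of \<open>u\<close>.\<close>

lemma trm_eqI:
  assumes "u \<in> trms n" "v \<in> trms n" "n > 0"
    and "\<And>p y. subterm_at p u = Some (Var y) \<Longrightarrow> subterm_at p v = Some (Var y)"
  shows "u = v"
proof -
  have "subst_trm Var u = v" using subst_eqI[OF assms(1-3)] assms(4) by blast
  moreover have "subst_trm Var u = u" using subst_eqI[OF assms(1,1,3)] by blast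
  ultimately show ?thesis by simp
qed

section \<open>Replacing a subterm\<close>

lemma subterm_at_replace:
  "subterm_at \<alpha> u \<noteq> None \<Longrightarrow> subterm_at (\<alpha> @ q) (replace_at \<alpha> u w) = subterm_at q w"
  by (induction \<alpha> u w rule: replace_at.induct) (auto split: if_splits)

lemma replace_at_replace:
  "subterm_at \<alpha> u \<noteq> None \<Longrightarrow> replace_at \<alpha> (replace_at \<alpha> u w) w' = replace_at \<alpha> u w'"
  by (induction \<alpha> u w rule: replace_at.induct) (auto split: if_splits)

lemma replace_at_same: "subterm_at \<alpha> u = Some w \<Longrightarrow> replace_at \<alpha> u w = u"
  by (induction \<alpha> u w rule: replace_at.induct) (auto split: if_splits)

lemma replace_at_trms:
  "u \<in> trms n \<Longrightarrow> w \<in> trms n \<Longrightarrow> subterm_at \<alpha> u \<noteq> None \<Longrightarrow> replace_at \<alpha> u w \<in> trms n"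
proof (induction \<alpha> u w rule: replace_at.induct)
  case (3 i \<alpha> us w)
  from 3(2) have "length us = n" "\<And>u. u \<in> set us \<Longrightarrow> u \<in> trms n" by (auto elim: trms.cases)
  then show ?case using 3
    by (auto split: if_splits intro!: trms.Op dest!: subsetD[OF set_update_subset_insert])
qed simp_all

text \<open>A leaf outside the subterm at \<open>\<alpha>\<close> cannot lie above
  \<open>\<alpha>\<close> either, since a subterm exists there. Its address thus branches off from
  \<open>\<alpha>\<close>: the replacement does not touch it and the two cones are disjoint.\<close>

lemma leaf_of_replace:
  "subterm_at \<alpha> u \<noteq> None \<Longrightarrow> subterm_at p u = Some (Var y) \<Longrightarrow> (\<And>q. p \<noteq> \<alpha> @ q) \<Longrightarrow>
   subterm_at p (replace_at \<alpha> u w) = Some (Var y) \<and> (\<forall>z z'. p @- z \<noteq> \<alpha> @- z')"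
proof (induction \<alpha> arbitrary: u p)
  case Nil
  then show ?case by (metis append_Nil)
next
  case (Cons i \<alpha>)
  then obtain us where u: "u = Op us" by (cases u) auto
  then obtain j q where p: "p = Suc j # q" "j < length us" "subterm_at q (us ! j) = Some (Var y)"
    using Cons.prems(2) by (auto simp: subterm_at_Op_iff)
  show ?case
  proof (cases "i = Suc j")
    case True
    then show ?thesis using Cons.IH[of "us ! j" q] Cons.prems u p by auto
  next
    case False
    then show ?thesis using Cons.prems u p by (auto split: if_splits simp: nth_list_update)
  qed
qed

section \<open>The permutation induced by a generator\<close>

definition act_below :: "nat \<Rightarrow> nat list \<Rightarrow> (nat stream \<times> nat stream) set \<Rightarrow> (nat stream \<times> nat stream) set" where
  "act_below n \<alpha> g = {(\<alpha> @- z, \<alpha> @- z') | z z'. (z, z') \<in> g} \<union> {(z, z) | z. z \<in> ends n \<and> (\<forall>w. z \<noteq> \<alpha> @- w)}"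

text \<open>The permutation of the ends induced by \<open>rho n s t\<close>; \<open>act_below\<close> transports it to an address.\<close>

definition match_rel :: "nat \<Rightarrow> 'v trm \<Rightarrow> 'v trm \<Rightarrow> (nat stream \<times> nat stream) set" where
  "match_rel n s t = {(p @- w, q @- w) | p q v w.
     subterm_at p s = Some (Var v) \<and> subterm_at q t = Some (Var v) \<and> w \<in> ends n}"

text \<open>Quantifying over the leaves of \<open>u\<close> only makes the invariant compose at
  once; as a term is determined by its labelled leaves, this still forces \<open>v = u\<close> when
  \<open>g\<close> is the identity.\<close>

definition leaf_matching :: "nat \<Rightarrow> (nat stream \<times> nat stream) set \<Rightarrow> ('v trm \<times> 'v trm) set" where
  "leaf_matching n g = {(u, v). u \<in> trms n \<and> v \<in> trms n \<and>
     (\<forall>p y. subterm_at p u = Some (Var y) \<longrightarrow> (\<exists>q. subterm_at q v = Some (Var y) \<and> maps_cone n g p q))}"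

text \<open>What the action needs to know of an equation: matching equal variables is a bijection
  between the leaves of the two sides.\<close>

definition balanced :: "nat \<Rightarrow> 'v trm \<Rightarrow> 'v trm \<Rightarrow> bool" where
  "balanced n s t \<longleftrightarrow> s \<in> trms n \<and> t \<in> trms n \<and> distinct (vlist s) \<and> distinct (vlist t) \<and>
     set (vlist s) = set (vlist t)"

lemma balanced_sym: "balanced n s t \<Longrightarrow> balanced n t s"
  by (auto simp: balanced_def)

lemma bij_rel_act_below:
  assumes "bij_rel (ends n) g" "\<alpha> \<in> lists {1..n}"
  shows "bij_rel (ends n) (act_below n \<alpha> g)"
proof (rule bij_relI)
  show "act_below n \<alpha> g \<subseteq> ends n \<times> ends n"
    using assms bij_rel_subset[OF assms(1)] unfolding act_below_def by fastforce
  show "\<exists>b. (a, b) \<in> act_below n \<alpha> g" if "a \<in> ends n" for a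
  proof (cases "\<exists>w. a = \<alpha> @- w")
    case True
    then obtain w where w: "a = \<alpha> @- w" by blast
    then have "w \<in> ends n" using that by simp
    then obtain w' where "(w, w') \<in> g" using bij_rel_total[OF assms(1)] by blast
    then show ?thesis using w unfolding act_below_def by blast
  qed (use that in \<open>auto simp: act_below_def\<close>)
  show "\<exists>b. (b, a) \<in> act_below n \<alpha> g" if "a \<in> ends n" for a
  proof (cases "\<exists>w. a = \<alpha> @- w")
    case True
    then obtain w where w: "a = \<alpha> @- w" by blast
    then have "w \<in> ends n" using that by simp
    then obtain w' where "(w', w) \<in> g" using bij_rel_surj[OF assms(1)] by blast
    then show ?thesis using w unfolding act_below_def by blast
  qed (use that in \<open>auto simp: act_below_def\<close>)
  show "b = c" if "(a, b) \<in> act_below n \<alpha> g" "(a, c) \<in> act_below n \<alpha> g" for a b c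
    using that bij_rel_functional[OF assms(1)] unfolding act_below_def by auto
  show "a = b" if "(a, c) \<in> act_below n \<alpha> g" "(b, c) \<in> act_below n \<alpha> g" for a b c
    using that bij_rel_inj[OF assms(1)] unfolding act_below_def by auto
qed

lemma act_below_converse: "(act_below n \<alpha> g)\<inverse> = act_below n \<alpha> (g\<inverse>)"
  unfolding act_below_def by blast

lemma maps_cone_act_below:
  "maps_cone n g p q \<Longrightarrow> maps_cone n (act_below n \<alpha> g) (\<alpha> @ p) (\<alpha> @ q)"
  unfolding maps_cone_def act_below_def by auto

lemma match_rel_converse: "(match_rel n s t)\<inverse> = match_rel n t s"
  unfolding match_rel_def by blast

text \<open>The leaves of \<open>s\<close> are prefix free, so \<open>a\<close> determines the leaf
  \<open>p\<close> and the tail \<open>w\<close>; linearity of \<open>t\<close> then determines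
  \<open>q\<close>.\<close>

lemma match_rel_functional:
  assumes "distinct (vlist t)" "(a, b) \<in> match_rel n s t" "(a, c) \<in> match_rel n s t"
  shows "b = c"
proof -
  obtain p q v w where 1: "a = p @- w" "b = q @- w" "subterm_at p s = Some (Var v)" "subterm_at q t = Some (Var v)"
    using assms(2) unfolding match_rel_def by blast
  obtain p' q' v' w' where 2: "a = p' @- w'" "c = q' @- w'" "subterm_at p' s = Some (Var v')" "subterm_at q' t = Some (Var v')"
    using assms(3) unfolding match_rel_def by blast
  have "p = p'" using 1 2 leaf_prefix_free by metis
  then have "w = w'" "v = v'" using 1 2 by auto
  then show ?thesis using 1 2 linear_leaf_unique[OF assms(1)] by blast
qed

lemma match_rel_total:
  assumes "balanced n s t" "a \<in> ends n"
  shows "\<exists>b. (a, b) \<in> match_rel n s t"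
proof -
  obtain p v w where p: "subterm_at p s = Some (Var v)" "w \<in> ends n" "a = p @- w"
    using leaf_cover assms unfolding balanced_def by metis
  then obtain q where "subterm_at q t = Some (Var v)"
    using assms(1) set_vlist unfolding balanced_def by metis
  then show ?thesis using p unfolding match_rel_def by blast
qed

lemma match_rel_subset:
  assumes "balanced n s t"
  shows "match_rel n s t \<subseteq> ends n \<times> ends n"
proof -
  have "s \<in> trms n" "t \<in> trms n" using assms by (auto simp: balanced_def)
  then show ?thesis using subterm_at_trms unfolding match_rel_def by fastforce
qed

lemma bij_rel_match_rel:
  assumes "balanced n s t"
  shows "bij_rel (ends n) (match_rel n s t)"
proof (rule bij_relI)
  have st: "distinct (vlist s)" "distinct (vlist t)" using assms by (auto simp: balanced_def)
  show "match_rel n s t \<subseteq> ends n \<times> ends n" using assms by (rule match_rel_subset)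
  show "\<exists>b. (a, b) \<in> match_rel n s t" if "a \<in> ends n" for a
    using match_rel_total[OF assms that] .
  show "\<exists>b. (b, a) \<in> match_rel n s t" if "a \<in> ends n" for a
    using match_rel_total[OF balanced_sym[OF assms] that] match_rel_converse[of n t s] by blast
  show "b = c" if "(a, b) \<in> match_rel n s t" "(a, c) \<in> match_rel n s t" for a b c
    using match_rel_functional[OF st(2)] that by blast
  show "a = b" if "(a, c) \<in> match_rel n s t" "(b, c) \<in> match_rel n s t" for a b c
    using match_rel_functional[OF st(1), of c a n t b] that match_rel_converse[of n t s] by blast
qed

text \<open>The datatype size is a crude bound on the height of \<open>s\<close>. It depends on the
  equation alone, as the depth constants of \<open>defined_deep\<close> require.\<close>

lemma length_le_size: "subterm_at p s = Some w \<Longrightarrow> length p \<le> size s"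
proof (induction p s rule: subterm_at.induct)
  case (3 i \<alpha> us)
  then have "us ! (i - 1) \<in> set us" "length \<alpha> \<le> size (us ! (i - 1))" by (auto split: if_splits)
  then have "length \<alpha> \<le> size_list size us" using size_list_estimation'[of _ us "length \<alpha>" size] by blast
  then show ?case by simp
qed auto

text \<open>A leaf below \<open>\<alpha>\<close> has an address \<open>\<alpha> @ p1 @ p2\<close>,
  where \<open>p1\<close> is a leaf of \<open>s\<close> carrying some \<open>v\<close> and
  \<open>p2\<close> is a leaf of \<open>\<phi> v\<close>. As \<open>v\<close> also occurs in
  \<open>t\<close>, at \<open>q1\<close> say, a copy of \<open>\<phi> v\<close> sits at
  \<open>\<alpha> @ q1\<close>. All other leaves stay in place. The length bound is what controls
  the loss of depth later.\<close>

lemma leaf_of_rho_at: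
  assumes "(u, u') \<in> rho_at n s t \<alpha>" "set (vlist s) \<subseteq> set (vlist t)" "u \<in> trms n"
    and "subterm_at p u = Some (Var y)"
  shows "\<exists>q. subterm_at q u' = Some (Var y) \<and> maps_cone n (act_below n \<alpha> (match_rel n s t)) p q \<and>
     length q \<le> length p + length \<alpha> + size t"
proof -
  obtain \<phi> where u: "u' = replace_at \<alpha> u (subst_trm \<phi> t)" "subterm_at \<alpha> u = Some (subst_trm \<phi> s)"
    using assms(1) unfolding rho_at_def rho_def by auto
  show ?thesis
  proof (cases "\<exists>p'. p = \<alpha> @ p'")
    case True
    then obtain p' where p: "p = \<alpha> @ p'" by blast
    then have "subterm_at p' (subst_trm \<phi> s) = Some (Var y)"
      using assms(4) u by (simp add: subterm_at_append)
    then obtain p1 p2 v where p': "p' = p1 @ p2" "subterm_at p1 s = Some (Var v)" "subterm_at p2 (\<phi> v) = Some (Var y)"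
      using leaf_of_subst by metis
    then obtain q1 where q1: "subterm_at q1 t = Some (Var v)" using assms(2) set_vlist by (metis subsetD)
    have "subterm_at (\<alpha> @ q1 @ p2) u' = Some (Var y)"
      using u q1 p' by (simp add: subterm_at_replace subterm_at_subst)
    moreover have "maps_cone n (match_rel n s t) (p1 @ p2) (q1 @ p2)"
      unfolding maps_cone_def
    proof
      fix w assume w: "w \<in> ends n"
      have "p2 \<in> lists {1..n}" using assms(3,4) p p' subterm_at_trms by fastforce
      then have "p2 @- w \<in> ends n" using w by simp
      then show "((p1 @ p2) @- w, (q1 @ p2) @- w) \<in> match_rel n s t"
        unfolding match_rel_def shift_append using p' q1 by blast
    qed
    then have "maps_cone n (act_below n \<alpha> (match_rel n s t)) p (\<alpha> @ q1 @ p2)"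
      unfolding p p' by (rule maps_cone_act_below)
    moreover have "length (\<alpha> @ q1 @ p2) \<le> length p + length \<alpha> + size t"
      using p p' length_le_size[OF q1] by simp
    ultimately show ?thesis by blast
  next
    case False
    then have *: "subterm_at p u' = Some (Var y)" "\<And>z z'. p @- z \<noteq> \<alpha> @- z'"
      using leaf_of_replace[of \<alpha> u p y] assms(4) u by auto
    have "p \<in> lists {1..n}" using assms(3,4) subterm_at_trms by blast
    then have "maps_cone n (act_below n \<alpha> (match_rel n s t)) p p"
      using *(2) unfolding maps_cone_def act_below_def by auto
    then show ?thesis using *(1) by auto
  qed
qed

lemma rho_at_subset:
  assumes "s \<in> trms n" "t \<in> trms n"
  shows "rho_at n s t \<alpha> \<subseteq> trms n \<times> trms n"
proof (rule subrelI)
  fix u u' assume "(u, u') \<in> rho_at n s t \<alpha>"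
  then obtain \<phi> where u: "u \<in> trms n" "u' = replace_at \<alpha> u (subst_trm \<phi> t)" "subterm_at \<alpha> u = Some (subst_trm \<phi> s)" "\<forall>v. \<phi> v \<in> trms n"
    unfolding rho_at_def rho_def by auto
  then have "u' \<in> trms n" using replace_at_trms[OF u(1) subst_trms[OF assms(2)]] by simp
  then show "(u, u') \<in> trms n \<times> trms n" using u(1) by simp
qed

text \<open>Overwriting the subterm at \<open>\<alpha>\<close> is undone by writing the old instance
  back, with the same substitution.\<close>

lemma rho_at_converse_subset:
  assumes "s \<in> trms n" "t \<in> trms n" "(u, u') \<in> rho_at n s t \<alpha>"
  shows "(u', u) \<in> rho_at n t s \<alpha>"
proof -
  obtain \<phi> where u: "u' = replace_at \<alpha> u (subst_trm \<phi> t)" "subterm_at \<alpha> u = Some (subst_trm \<phi> s)" "\<forall>v. \<phi> v \<in> trms n"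
    using assms(3) unfolding rho_at_def rho_def by auto
  have "u = replace_at \<alpha> u' (subst_trm \<phi> s)"
    using u by (simp add: replace_at_replace replace_at_same)
  moreover have "subterm_at \<alpha> u' = Some (subst_trm \<phi> t)"
    using u subterm_at_replace[of \<alpha> u "[]"] by simp
  moreover have "u' \<in> trms n" using rho_at_subset assms by fast
  ultimately show ?thesis using u(3) unfolding rho_at_def rho_def by blast
qed

lemma rho_at_converse:
  assumes "s \<in> trms n" "t \<in> trms n"
  shows "(rho_at n s t \<alpha>)\<inverse> = rho_at n t s \<alpha>"
  using rho_at_converse_subset[OF assms] rho_at_converse_subset[OF assms(2,1)] by auto

lemma rho_at_leaf_matching:
  assumes "balanced n s t"
  shows "rho_at n s t \<alpha> \<subseteq> leaf_matching n (act_below n \<alpha> (match_rel n s t))"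
proof (rule subrelI)
  fix u u' :: "'a trm" assume uu': "(u, u') \<in> rho_at n s t \<alpha>"
  moreover have "u \<in> trms n" "u' \<in> trms n"
    using uu' rho_at_subset assms unfolding balanced_def by fast+
  moreover have "set (vlist s) \<subseteq> set (vlist t)" using assms by (simp add: balanced_def)
  ultimately show "(u, u') \<in> leaf_matching n (act_below n \<alpha> (match_rel n s t))"
    unfolding leaf_matching_def using leaf_of_rho_at[OF uu'] by blast
qed

text \<open>Words with equal cones are equal by \<open>cone_eqD\<close>, so each labelled leaf of
  \<open>u\<close> is found in \<open>v\<close> at its own address.\<close>

lemma leaf_matching_Id:
  assumes "n \<ge> 2" shows "leaf_matching n (Id_on (ends n)) \<subseteq> Id"
proof (rule subrelI)
  fix u v :: "'a trm" assume *: "(u, v) \<in> leaf_matching n (Id_on (ends n))"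
  have "subterm_at p v = Some (Var y)" if p: "subterm_at p u = Some (Var y)" for p y
  proof -
    obtain q where q: "subterm_at q v = Some (Var y)" "maps_cone n (Id_on (ends n)) p q"
      using * p unfolding leaf_matching_def by blast
    have "p = q"
      by (rule cone_eqD[OF assms]) (use q(2) in \<open>auto simp: maps_cone_def\<close>)
    then show ?thesis using q by simp
  qed
  then show "(u, v) \<in> Id" using trm_eqI[of u n v] * assms unfolding leaf_matching_def by fastforce
qed

lemma leaf_matching_comp: "leaf_matching n g O leaf_matching n h \<subseteq> leaf_matching n (g O h)"
  unfolding leaf_matching_def using maps_cone_comp by fast

section \<open>Every word is defined on deep terms\<close>

definition deep :: "nat \<Rightarrow> 'v trm \<Rightarrow> bool" where
  "deep k u \<longleftrightarrow> (\<forall>p y. subterm_at p u = Some (Var y) \<longrightarrow> k \<le> length p)"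

text \<open>The bound \<open>C\<close> on the loss of depth is what makes the property closed under composition.\<close>

definition defined_deep :: "nat \<Rightarrow> ('v trm \<times> 'v trm) set \<Rightarrow> bool" where
  "defined_deep n f \<longleftrightarrow> (\<exists>N C. (\<forall>u\<in>trms n. deep N u \<longrightarrow> u \<in> Domain f) \<and>
     (\<forall>(u, v)\<in>f. \<forall>k. deep (k + C) u \<longrightarrow> deep k v))"

lemma deep_mono: "deep k u \<Longrightarrow> j \<le> k \<Longrightarrow> deep j u"
  unfolding deep_def by (meson le_trans)

lemma defined_deep_comp:
  assumes "f \<subseteq> trms n \<times> trms n" "defined_deep n f" "defined_deep n g"
  shows "defined_deep n (f O g)"
proof -
  obtain N C where f: "\<And>u. u \<in> trms n \<Longrightarrow> deep N u \<Longrightarrow> u \<in> Domain f"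
    "\<And>u v k. (u, v) \<in> f \<Longrightarrow> deep (k + C) u \<Longrightarrow> deep k v"
    using assms(2) unfolding defined_deep_def by fast
  obtain M D where g: "\<And>u. u \<in> trms n \<Longrightarrow> deep M u \<Longrightarrow> u \<in> Domain g"
    "\<And>u v k. (u, v) \<in> g \<Longrightarrow> deep (k + D) u \<Longrightarrow> deep k v"
    using assms(3) unfolding defined_deep_def by fast
  \<comment> \<open>Depth \<open>N\<close> puts \<open>u\<close> into the domain of
    \<open>f\<close>; depth \<open>M + C\<close> leaves depth \<open>M\<close> after
    \<open>f\<close> has lost at most \<open>C\<close>, which puts the image into the domain of
    \<open>g\<close>.\<close>
  have "u \<in> Domain (f O g)" if u: "u \<in> trms n" "deep (N + M + C) u" for u
  proof -
    have "deep N u" by (rule deep_mono[OF u(2)]) simp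
    then obtain v where v: "(u, v) \<in> f" using f(1) u(1) by blast
    have "deep (M + C) u" by (rule deep_mono[OF u(2)]) simp
    then have "v \<in> Domain g" using f(2) v g(1) assms(1) by blast
    then show ?thesis using v by blast
  qed
  moreover have "deep k w" if "(u, w) \<in> f O g" "deep (k + (D + C)) u" for u w k
  proof -
    obtain v where v: "(u, v) \<in> f" "(v, w) \<in> g" using \<open>(u, w) \<in> f O g\<close> by blast
    have "deep (k + D + C) u" using that(2) by (simp add: add.assoc)
    then show ?thesis using f(2) g(2) v by blast
  qed
  ultimately show ?thesis unfolding defined_deep_def by blast
qed

lemma deep_subterm_defined:
  assumes "u \<in> trms n" "p \<in> lists {1..n}" "deep k u" "length p \<le> k"
  shows "\<exists>w. subterm_at p u = Some w \<and> w \<in> trms n \<and> deep (k - length p) w"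
  using assms
proof (induction p arbitrary: u k)
  case Nil
  then show ?case by simp
next
  case (Cons i p)
  obtain us where u: "u = Op us" using Cons.prems(3,4) by (cases u) (auto simp: deep_def dest!: spec[of _ "[]"])
  then have us: "length us = n" "\<And>u. u \<in> set us \<Longrightarrow> u \<in> trms n"
    using Cons.prems(1) by (auto elim: trms.cases)
  have i: "1 \<le> i" "i \<le> n" using Cons.prems(2) by auto
  then have mem: "us ! (i - 1) \<in> trms n" using us by (auto intro!: us(2) nth_mem)
  have dp: "deep (m - 1) (us ! (i - 1))" if "deep m u" for m
    unfolding deep_def
  proof (intro allI impI)
    fix q y assume "subterm_at q (us ! (i - 1)) = Some (Var y)"
    then have "subterm_at (i # q) u = Some (Var y)" using u i us by simp
    then have "m \<le> length (i # q)" using \<open>deep m u\<close> unfolding deep_def by blast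
    then show "m - 1 \<le> length q" by simp
  qed
  have "\<exists>w. subterm_at p (us ! (i - 1)) = Some w \<and> w \<in> trms n \<and> deep ((k - 1) - length p) w"
    by (rule Cons.IH) (use Cons.prems mem dp[OF Cons.prems(3)] in auto)
  then show ?case using u us i by auto
qed

text \<open>No leaf of \<open>u\<close> lies strictly above a leaf of \<open>s\<close>, so
  \<open>u\<close> has a subterm at every leaf of \<open>s\<close>. Linearity of \<open>s\<close>
  allows these subterms to be prescribed independently as values of the substitution.\<close>

lemma deep_instance:
  assumes "s \<in> trms n" "distinct (vlist s)" "u \<in> trms n" "deep (size s) u" "n > 0"
  shows "\<exists>\<phi>. (\<forall>v. \<phi> v \<in> trms n) \<and> subst_trm \<phi> s = u"
proof -
  \<comment> \<open>The description is unique because \<open>v\<close> occurs at most once in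
    \<open>s\<close>. Variables that do not occur get the default \<open>Var v\<close>, so that all
    values are terms in \<open>trms n\<close>.\<close>
  define \<phi> where "\<phi> v = (if \<exists>p w. subterm_at p s = Some (Var v) \<and> subterm_at p u = Some w
     then THE w. \<exists>p. subterm_at p s = Some (Var v) \<and> subterm_at p u = Some w else Var v)" for v
  have \<phi>: "\<phi> v = w" if "subterm_at p s = Some (Var v)" "subterm_at p u = Some w" for p v w
  proof -
    have "(THE w. \<exists>p. subterm_at p s = Some (Var v) \<and> subterm_at p u = Some w) = w"
    proof (rule the_equality)
      show "\<exists>p. subterm_at p s = Some (Var v) \<and> subterm_at p u = Some w" using that by blast
      fix w' assume "\<exists>p. subterm_at p s = Some (Var v) \<and> subterm_at p u = Some w'"
      then obtain q where q: "subterm_at q s = Some (Var v)" "subterm_at q u = Some w'" by blast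
      then have "q = p" using linear_leaf_unique[OF assms(2)] that(1) by blast
      then show "w' = w" using q that(2) by simp
    qed
    then show ?thesis using that unfolding \<phi>_def by auto
  qed
  have "\<phi> v \<in> trms n" for v
  proof (cases "\<exists>p w. subterm_at p s = Some (Var v) \<and> subterm_at p u = Some w")
    case True
    then obtain p w where "subterm_at p s = Some (Var v)" "subterm_at p u = Some w" by blast
    then show ?thesis using \<phi> subterm_at_trms[OF _ assms(3)] by simp
  next
    case False
    then show ?thesis unfolding \<phi>_def by (simp only: if_False trms.Var)
  qed
  moreover have "subst_trm \<phi> s = u"
  proof (rule subst_eqI[OF assms(1,3,5)])
    fix p v assume p: "subterm_at p s = Some (Var v)"
    then have "length p \<le> size s" "p \<in> lists {1..n}" using length_le_size subterm_at_trms assms(1) by blast+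
    then have "\<exists>w. subterm_at p u = Some w"
      using deep_subterm_defined[of u n p "size s"] assms by blast
    then show "subterm_at p u = Some (\<phi> v)" using \<phi> p by blast
  qed
  ultimately show ?thesis by blast
qed

text \<open>The loss of depth is found by running the step backwards: applied to the reverse pair,
  \<open>leaf_of_rho_at\<close> traces a leaf of \<open>v\<close> to a leaf of \<open>u\<close> that
  is longer by at most \<open>length \<alpha> + size s\<close>.\<close>

lemma rho_at_defined_deep:
  assumes "balanced n s t" "\<alpha> \<in> lists {1..n}" "n > 0"
  shows "defined_deep n (rho_at n s t \<alpha>)"
proof -
  have st: "s \<in> trms n" "t \<in> trms n" "distinct (vlist s)" "set (vlist t) \<subseteq> set (vlist s)"
    using assms by (auto simp: balanced_def)
  have "u \<in> Domain (rho_at n s t \<alpha>)" if u: "u \<in> trms n" "deep (length \<alpha> + size s) u" for u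
  proof -
    obtain w where w: "subterm_at \<alpha> u = Some w" "w \<in> trms n" "deep (size s) w"
      using deep_subterm_defined[OF u(1) assms(2) u(2)] by auto
    obtain \<phi> where \<phi>: "\<forall>v. \<phi> v \<in> trms n" "subst_trm \<phi> s = w"
      using deep_instance st w assms(3) by metis
    then have "(u, replace_at \<alpha> u (subst_trm \<phi> t)) \<in> rho_at n s t \<alpha>"
      using u(1) w(1) unfolding rho_at_def rho_def by blast
    then show ?thesis by blast
  qed
  moreover have "deep k v" if uv: "(u, v) \<in> rho_at n s t \<alpha>" "deep (k + (length \<alpha> + size s)) u" for u v k
    unfolding deep_def
  proof (intro allI impI)
    fix q y assume q: "subterm_at q v = Some (Var y)"
    have vu: "(v, u) \<in> rho_at n t s \<alpha>" using rho_at_converse_subset st uv(1) by blast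
    then have "v \<in> trms n" using rho_at_subset st by blast
    then obtain p where "subterm_at p u = Some (Var y)" "length p \<le> length q + length \<alpha> + size s"
      using leaf_of_rho_at[OF vu st(4) _ q] by blast
    then show "k \<le> length q" using uv(2) unfolding deep_def by fastforce
  qed
  ultimately show ?thesis unfolding defined_deep_def by blast
qed

section \<open>The equations are balanced\<close>

lemma concat_map_vlist_vars [simp]: "concat (map vlist (vars x i j)) = map x [i..<Suc j]"
  unfolding vars_def by (simp add: concat_map_singleton o_def)

lemma length_vars [simp]: "length (vars x i j) = Suc j - i"
  by (simp add: vars_def Suc_diff_le del: upt_Suc)

lemma vars_in_trms: "u \<in> set (vars x i j) \<Longrightarrow> u \<in> trms n"
  by (auto simp: vars_def intro: trms.Var)

lemma upt_append: "i \<le> j \<Longrightarrow> j \<le> k \<Longrightarrow> [i..<j] @ [j..<k] = [i..<k]"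
  by (metis upt_add_eq_append le_add_diff_inverse)

text \<open>Both sides of an associativity equation list the variables with indices \<open>1\<close>
  to \<open>2 * n - 1\<close> in order; the two sides of a symmetry equation list those up to
  \<open>n\<close>, one with two neighbours exchanged. Injectivity of \<open>x\<close> turns
  distinct indices into distinct variables.\<close>

lemma SC_equations_balanced:
  assumes "(s, t) \<in> SC_equations n x" "inj_on x {1..2 * n - 1}"
  shows "balanced n s t"
  using assms(1) unfolding SC_equations_def
proof (elim UnE CollectE exE conjE)
  fix i assume i: "0 < i" "i < n" and st: "(s, t) =
       (Op (vars x 1 i @ [Op (vars x (i + 1) (i + n))] @ vars x (i + n + 1) (2 * n - 1)),
        Op (vars x 1 (i - 1) @ [Op (vars x i (i + n - 1))] @ vars x (i + n) (2 * n - 1)))"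
  have "vlist s = map x ([1..<Suc i] @ [Suc i..<Suc (i + n)] @ [Suc (i + n)..<Suc (2 * n - 1)])"
    using st by simp
  also have "\<dots> = map x [1..<2 * n]" using i by (subst upt_append, simp, simp)+ simp
  finally have s: "vlist s = map x [1..<2 * n]" .
  have "vlist t = map x ([1..<i] @ [i..<i + n] @ [i + n..<Suc (2 * n - 1)])"
    using st i by simp
  also have "\<dots> = map x [1..<2 * n]" using i by (subst upt_append, simp, simp)+ simp
  finally have t: "vlist t = map x [1..<2 * n]" .
  have "inj_on x {1..<2 * n}" by (rule inj_on_subset[OF assms(2)]) auto
  then have "distinct (map x [1..<2 * n])" by (simp add: distinct_map)
  moreover have "s \<in> trms n" "t \<in> trms n" using st i
    by (auto intro!: trms.Op intro: vars_in_trms)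
  ultimately show ?thesis unfolding balanced_def s t by simp
next
  fix i assume i: "1 \<le> i" "i < n" and st: "(s, t) =
       (Op (vars x 1 (i - 1) @ [Var (x i), Var (x (i + 1))] @ vars x (i + 2) n),
        Op (vars x 1 (i - 1) @ [Var (x (i + 1)), Var (x i)] @ vars x (i + 2) n))"
  have v: "vlist s = map x ([1..<i] @ [i, Suc i] @ [i + 2..<Suc n])"
    "vlist t = map x ([1..<i] @ [Suc i, i] @ [i + 2..<Suc n])" using st i by auto
  have "inj_on x (set ([1..<i] @ [i, Suc i] @ [i + 2..<Suc n]))"
    by (rule inj_on_subset[OF assms(2)]) (use i in auto)
  then have "distinct (vlist s)" unfolding v distinct_map by auto
  have "inj_on x (set ([1..<i] @ [Suc i, i] @ [i + 2..<Suc n]))"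
    by (rule inj_on_subset[OF assms(2)]) (use i in auto)
  then have "distinct (vlist t)" unfolding v distinct_map by auto
  moreover have "s \<in> trms n" "t \<in> trms n" using st i
    by (auto intro!: trms.Op intro: vars_in_trms trms.Var)
  moreover have "set (vlist s) = set (vlist t)" unfolding v by auto
  ultimately show ?thesis using \<open>distinct (vlist s)\<close> unfolding balanced_def by simp
qed

subsection \<open>The universal group as a group of permutations of the ends\<close>

text \<open>The permutation is read off a word in the generators; that it depends only on the partial
  map represented by the word is the lemma \<open>realizes_functional\<close>.\<close>

inductive_set realizes :: "nat \<Rightarrow> (nat \<Rightarrow> 'v) \<Rightarrow> (('v trm \<times> 'v trm) set \<times> (nat stream \<times> nat stream) set) set"
  for n :: nat and x :: "nat \<Rightarrow> 'v" where
  ident: "(Id_on (trms n), Id_on (ends n)) \<in> realizes n x"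
| gen: "\<lbrakk>(s, t) \<in> SC_equations n x \<or> (t, s) \<in> SC_equations n x; set \<alpha> \<subseteq> {1..n}\<rbrakk>
    \<Longrightarrow> (rho_at n s t \<alpha>, act_below n \<alpha> (match_rel n s t)) \<in> realizes n x"
| comp: "\<lbrakk>(f, g) \<in> realizes n x; (f', g') \<in> realizes n x\<rbrakk> \<Longrightarrow> (f O f', g O g') \<in> realizes n x"

abbreviation end_perms :: "nat \<Rightarrow> (nat \<Rightarrow> 'v) \<Rightarrow> (nat stream \<times> nat stream) set set" where
  "end_perms n x \<equiv> Range (realizes n x)"

lemma Struct_carrier_iff: "f \<in> Struct_carrier n x \<longleftrightarrow> (\<exists>g. (f, g) \<in> realizes n x)"
proof
  show "f \<in> Struct_carrier n x \<Longrightarrow> \<exists>g. (f, g) \<in> realizes n x"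
    by (induction rule: Struct_carrier.induct) (blast intro: realizes.intros)+
  show "\<exists>g. (f, g) \<in> realizes n x \<Longrightarrow> f \<in> Struct_carrier n x"
  proof (elim exE)
    fix g assume "(f, g) \<in> realizes n x"
    then show "f \<in> Struct_carrier n x"
      by (induction rule: realizes.induct) (blast intro: Struct_carrier.intros)+
  qed
qed

section \<open>Complete terms as probes\<close>

text \<open>The labelling \<open>h\<close> is free: with \<open>N\<close> large the term lies in the
  domain of a given map, and the labels then show where the leaves go.\<close>

primrec full_trm :: "nat \<Rightarrow> nat \<Rightarrow> (nat list \<Rightarrow> 'v) \<Rightarrow> 'v trm" where
  "full_trm n 0 h = Var (h [])"
| "full_trm n (Suc N) h = Op (map (\<lambda>i. full_trm n N (\<lambda>p. h (Suc i # p))) [0..<n])"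

lemma full_trm_trms: "full_trm n N h \<in> trms n"
  by (induction N arbitrary: h) (auto intro!: trms.intros)

lemma leaf_full_trm:
  "subterm_at p (full_trm n N h) = Some (Var y) \<longleftrightarrow> p \<in> lists {1..n} \<and> length p = N \<and> y = h p"
proof (induction N arbitrary: p h)
  case 0
  then show ?case by (cases p) auto
next
  case (Suc N)
  have "subterm_at p (full_trm n (Suc N) h) = Some (Var y) \<longleftrightarrow>
    (\<exists>i q. p = Suc i # q \<and> i < n \<and> q \<in> lists {1..n} \<and> length q = N \<and> y = h (Suc i # q))"
    using Suc.IH by (auto simp: subterm_at_Op_iff simp del: upt_Suc)
  also have "\<dots> \<longleftrightarrow> p \<in> lists {1..n} \<and> length p = Suc N \<and> y = h p"
    by (cases p; cases "hd p") auto
  finally show ?case .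
qed

lemma deep_full_trm: "deep N (full_trm n N h)"
  unfolding deep_def by (simp add: leaf_full_trm)

lemma ends_split: "z \<in> ends n \<Longrightarrow> \<exists>p w. z = p @- w \<and> p \<in> lists {1..n} \<and> length p = N \<and> w \<in> ends n"
proof (induction N arbitrary: z)
  case 0
  then show ?case by (metis length_0_conv lists.Nil shift.simps(1))
next
  case (Suc N)
  obtain i z' where z: "z = i ## z'" "z' \<in> ends n" "i \<in> {1..n}"
    using Suc.prems by (cases z) auto
  then obtain p w where "z' = p @- w \<and> p \<in> lists {1..n} \<and> length p = N \<and> w \<in> ends n"
    using Suc.IH by blast
  then show ?case using z by (intro exI[of _ "i # p"] exI[of _ w]) auto
qed

section \<open>The map from words to permutations\<close>

context
  fixes n :: nat and x :: "nat \<Rightarrow> 'v"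
  assumes n2: "n \<ge> 2" and inj: "inj_on x {1..2 * n - 1}"
begin

lemma generator_balanced:
  "(s, t) \<in> SC_equations n x \<or> (t, s) \<in> SC_equations n x \<Longrightarrow> balanced n s t"
  using SC_equations_balanced inj balanced_sym by blast

lemma realizes_bij_rel: "(f, g) \<in> realizes n x \<Longrightarrow> bij_rel (ends n) g"
proof (induction rule: realizes.induct)
  case ident
  show ?case by (rule bij_rel_Id_on)
next
  case (gen s t \<alpha>)
  then show ?case by (intro bij_rel_act_below bij_rel_match_rel generator_balanced) auto
next
  case (comp f g f' g')
  then show ?case by (intro bij_rel_comp)
qed

lemma realizes_subset: "(f, g) \<in> realizes n x \<Longrightarrow> f \<subseteq> trms n \<times> trms n"
proof (induction rule: realizes.induct)
  case (gen s t \<alpha>)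
  have "balanced n s t" using gen generator_balanced by blast
  then show ?case by (intro rho_at_subset) (auto simp: balanced_def)
qed auto

lemma realizes_leaf_matching: "(f, g) \<in> realizes n x \<Longrightarrow> f \<subseteq> leaf_matching n g"
proof (induction rule: realizes.induct)
  case ident
  show ?case
  proof
    fix z :: "'v trm \<times> 'v trm" assume "z \<in> Id_on (trms n)"
    then obtain u where "z = (u, u)" "u \<in> trms n" by blast
    then show "z \<in> leaf_matching n (Id_on (ends n))"
      using subterm_at_trms unfolding leaf_matching_def maps_cone_def by fastforce
  qed
next
  case (gen s t \<alpha>)
  then show ?case using rho_at_leaf_matching generator_balanced by blast
next
  case (comp f g f' g')
  then show ?case using leaf_matching_comp by blast
qed

lemma realizes_defined_deep: "(f, g) \<in> realizes n x \<Longrightarrow> defined_deep n f"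
proof (induction rule: realizes.induct)
  case ident
  have "(\<forall>u\<in>trms n. deep 0 u \<longrightarrow> u \<in> Domain (Id_on (trms n :: 'v trm set))) \<and>
     (\<forall>(u, v)\<in>Id_on (trms n :: 'v trm set). \<forall>k. deep (k + 0) u \<longrightarrow> deep k v)" by auto
  then show ?case unfolding defined_deep_def by blast
next
  case (gen s t \<alpha>)
  then show ?case using rho_at_defined_deep[of n s t \<alpha>] generator_balanced n2 by auto
next
  case (comp f g f' g')
  then show ?case using defined_deep_comp realizes_subset by blast
qed

text \<open>Equations may be used in both directions, so the reverse of a word in the generators is
  again such a word. This supplies the inverses on both sides of \<open>realizes\<close>.\<close>

lemma realizes_converse: "(f, g) \<in> realizes n x \<Longrightarrow> (f\<inverse>, g\<inverse>) \<in> realizes n x"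
proof (induction rule: realizes.induct)
  case ident
  show ?case using realizes.ident by simp
next
  case (gen s t \<alpha>)
  then have "balanced n s t" using generator_balanced by blast
  then have "(rho_at n s t \<alpha>)\<inverse> = rho_at n t s \<alpha>" by (intro rho_at_converse) (auto simp: balanced_def)
  moreover have "(rho_at n t s \<alpha>, act_below n \<alpha> (match_rel n t s)) \<in> realizes n x"
    using gen realizes.gen by blast
  ultimately show ?case by (simp add: act_below_converse match_rel_converse)
next
  case (comp f g f' g')
  then show ?case using realizes.comp by (simp add: converse_relcomp)
qed

lemma realizes_full:
  assumes "(f, g) \<in> realizes n x"
  shows "\<exists>N. \<forall>h. \<exists>v. (full_trm n N h, v) \<in> f"
  using realizes_defined_deep[OF assms] full_trm_trms deep_full_trm unfolding defined_deep_def by blast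

text \<open>Applying \<open>f\<close> to one complete term in its domain yields an image address for
  each leaf, that is, for every word of length \<open>N\<close>.\<close>

lemma realizes_maps_cones:
  assumes "(f, g) \<in> realizes n x"
  shows "\<exists>N. \<forall>p\<in>lists {1..n}. length p = N \<longrightarrow> (\<exists>q\<in>lists {1..n}. maps_cone n g p q)"
proof -
  obtain N v where v: "(full_trm n N (\<lambda>_. x 1), v) \<in> f" using realizes_full[OF assms] by blast
  then have "(full_trm n N (\<lambda>_. x 1), v) \<in> leaf_matching n g" using realizes_leaf_matching[OF assms] by blast
  then have *: "v \<in> trms n" "\<And>p y. subterm_at p (full_trm n N (\<lambda>_. x 1)) = Some (Var y) \<Longrightarrow>
      \<exists>q. subterm_at q v = Some (Var y) \<and> maps_cone n g p q" unfolding leaf_matching_def by auto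
  have "\<exists>q\<in>lists {1..n}. maps_cone n g p q" if "p \<in> lists {1..n}" "length p = N" for p
    using *(2)[of p "x 1"] that subterm_at_trms[OF _ *(1)] by (auto simp: leaf_full_trm)
  then show ?thesis by blast
qed

text \<open>Labelling one leaf of a complete tree differently from all the others forces
  its cone to be fixed.\<close>

lemma realizes_idempotent:
  assumes "(e, g) \<in> realizes n x" "e \<subseteq> Id"
  shows "g = Id_on (ends n)"
proof -
  obtain N where N: "\<And>h. \<exists>v. (full_trm n N h, v) \<in> e" using realizes_full[OF assms(1)] by blast
  have x: "x 1 \<noteq> x 2" using inj n2 by (auto dest: inj_onD)
  have fixed: "maps_cone n g p p" if p: "p \<in> lists {1..n}" "length p = N" for p
  proof -
    define u where "u = full_trm n N (\<lambda>q. if q = p then x 1 else x 2)"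
    have "(u, u) \<in> e" using N assms(2) unfolding u_def by fastforce
    then have "(u, u) \<in> leaf_matching n g" using realizes_leaf_matching[OF assms(1)] by blast
    moreover have "subterm_at p u = Some (Var (x 1))" using p by (simp add: u_def leaf_full_trm)
    ultimately obtain q where q: "subterm_at q u = Some (Var (x 1))" "maps_cone n g p q"
      unfolding leaf_matching_def by blast
    then have "x 1 = (if q = p then x 1 else x 2)" unfolding u_def leaf_full_trm by blast
    then have "q = p" using x by presburger
    then show ?thesis using q by simp
  qed
  have "Id_on (ends n) \<subseteq> g"
  proof
    fix y assume "y \<in> Id_on (ends n)"
    then obtain z where z: "y = (z, z)" "z \<in> ends n" by blast
    then obtain p w where "z = p @- w" "p \<in> lists {1..n}" "length p = N" "w \<in> ends n"
      using ends_split[of z n N] by blast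
    then show "y \<in> g" using fixed z unfolding maps_cone_def by blast
  qed
  then show ?thesis using bij_rel_eqI[OF bij_rel_Id_on realizes_bij_rel[OF assms(1)]] by simp
qed

lemma realizes_subset_Id: "(e, Id_on (ends n)) \<in> realizes n x \<Longrightarrow> e \<subseteq> Id"
  using realizes_leaf_matching leaf_matching_Id n2 by blast

text \<open>The map \<open>f O f\<inverse>\<close> realizes \<open>g O g\<inverse>\<close>, which is
  the identity, so it lies in \<open>Id\<close>. But it also realizes
  \<open>g O g'\<inverse>\<close>, which is then the identity by
  \<open>realizes_idempotent\<close>.\<close>

lemma realizes_functional:
  assumes "(f, g) \<in> realizes n x" "(f, g') \<in> realizes n x"
  shows "g = g'"
proof -
  have b: "bij_rel (ends n) g" "bij_rel (ends n) g'" using assms realizes_bij_rel by blast+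
  have "(f O f\<inverse>, g O g\<inverse>) \<in> realizes n x" using assms realizes_converse realizes.comp by blast
  then have "f O f\<inverse> \<subseteq> Id" using realizes_subset_Id bij_rel_comp_converse[OF b(1)] by simp
  moreover have "(f O f\<inverse>, g O g'\<inverse>) \<in> realizes n x" using assms realizes_converse realizes.comp by blast
  ultimately have *: "g O g'\<inverse> = Id_on (ends n)" by (rule realizes_idempotent[rotated])
  have "g = g O (g'\<inverse> O g')" using b bij_rel_comp_Id_on bij_rel_converse_comp by metis
  also have "\<dots> = (g O g'\<inverse>) O g'" by (simp add: O_assoc)
  finally show ?thesis using * bij_rel_comp_Id_on(2)[OF b(2)] by simp
qed

text \<open>An idempotent realizes some \<open>g\<close> with \<open>g O g = g\<close>, and
  cancelling in the permutations gives the identity; the other rules preserve equality of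
  permutations. Conversely, if \<open>f\<close> and \<open>f'\<close> realize the same
  \<open>g\<close>, then \<open>f O f'\<inverse>\<close> and \<open>f'\<inverse> O f'\<close>
  realize the identity, so they are idempotent and congruent to the unit. Bracketing
  \<open>f O f'\<inverse> O f'\<close> in both ways joins \<open>f\<close> to
  \<open>f'\<close>.\<close>

lemma idem_cong_Struct:
  "idem_cong (Struct n x) = {(f, f'). \<exists>g. (f, g) \<in> realizes n x \<and> (f', g) \<in> realizes n x}"
proof (intro equalityI subrelI)
  fix f f' assume "(f, f') \<in> idem_cong (Struct n x)"
  then show "(f, f') \<in> {(f, f'). \<exists>g. (f, g) \<in> realizes n x \<and> (f', g) \<in> realizes n x}"
  proof (induction rule: idem_cong.induct)
    case (idem e)
    then obtain g where g: "(e, g) \<in> realizes n x" by (auto simp: Struct_def Struct_carrier_iff)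
    have e: "e O e = e" using idem by (simp add: Struct_def)
    have "(e O e, g O g) \<in> realizes n x" using g realizes.comp by blast
    then have "g O g = g" using g e realizes_functional by simp
    then have "g O (g O g\<inverse>) = g O g\<inverse>" by (simp flip: O_assoc)
    then have "g = Id_on (ends n)"
      using bij_rel_comp_converse bij_rel_comp_Id_on(1) realizes_bij_rel[OF g] by metis
    then show ?case using g realizes.ident by (auto simp: Struct_def)
  next
    case (refl a)
    then show ?case by (auto simp: Struct_def Struct_carrier_iff)
  next
    case (trans a b c)
    then show ?case using realizes_functional by blast
  next
    case (mult a b c d)
    then show ?case using realizes.comp by (fastforce simp: Struct_def)
  qed blast
next
  fix f f' assume "(f, f') \<in> {(f, f'). \<exists>g. (f, g) \<in> realizes n x \<and> (f', g) \<in> realizes n x}"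
  then obtain g where g: "(f, g) \<in> realizes n x" "(f', g) \<in> realizes n x" by blast
  have car: "f \<in> Struct_carrier n x" "f' \<in> Struct_carrier n x" "f'\<inverse> \<in> Struct_carrier n x"
    using g realizes_converse Struct_carrier_iff by blast+
  have idem: "(e, Id_on (trms n)) \<in> idem_cong (Struct n x)" if "(e, Id_on (ends n)) \<in> realizes n x" for e
  proof -
    have "e \<subseteq> Id" using that realizes_subset_Id by blast
    then have "e O e = e" by blast
    moreover have "e \<in> Struct_carrier n x" using that Struct_carrier_iff by blast
    ultimately show ?thesis using idem_cong.idem[of e "Struct n x"] by (simp add: Struct_def)
  qed
  have mult: "(a O c, b O d) \<in> idem_cong (Struct n x)" if "(a, b) \<in> idem_cong (Struct n x)" "(c, d) \<in> idem_cong (Struct n x)" for a b c d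
    using idem_cong.mult[OF that] by (simp add: Struct_def)
  have refl: "(a, a) \<in> idem_cong (Struct n x)" if "a \<in> Struct_carrier n x" for a
    using idem_cong.refl[of a "Struct n x"] that by (simp add: Struct_def)
  have "(f' O f'\<inverse>, Id_on (ends n)) \<in> realizes n x" "(f O f'\<inverse>, Id_on (ends n)) \<in> realizes n x"
    "(f'\<inverse> O f', Id_on (ends n)) \<in> realizes n x"
    using realizes.comp[OF g(2) realizes_converse[OF g(2)]] realizes.comp[OF g(1) realizes_converse[OF g(2)]]
      realizes.comp[OF realizes_converse[OF g(2)] g(2)]
    unfolding bij_rel_comp_converse[OF realizes_bij_rel[OF g(1)]] bij_rel_converse_comp[OF realizes_bij_rel[OF g(1)]] .
  then have *: "(f O f'\<inverse>, Id_on (trms n)) \<in> idem_cong (Struct n x)" "(f'\<inverse> O f', Id_on (trms n)) \<in> idem_cong (Struct n x)"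
    using idem by blast+
  have sub: "f \<subseteq> trms n \<times> trms n" "f' \<subseteq> trms n \<times> trms n" using g realizes_subset by blast+
  have "(f O (f'\<inverse> O f'), f O Id_on (trms n)) \<in> idem_cong (Struct n x)"
    using mult refl car * by blast
  moreover have "((f O f'\<inverse>) O f', Id_on (trms n) O f') \<in> idem_cong (Struct n x)"
    using mult refl car * by blast
  moreover have "f O Id_on (trms n) = f" "Id_on (trms n) O f' = f'" using sub by auto
  ultimately show "(f, f') \<in> idem_cong (Struct n x)" by (metis O_assoc idem_cong.sym idem_cong.trans)
qed

end

section \<open>Transport of the group structure along fibres\<close>

definition end_group :: "nat \<Rightarrow> (nat \<Rightarrow> 'v) \<Rightarrow> (nat stream \<times> nat stream) set monoid" where
  "end_group n x = \<lparr>carrier = end_perms n x, monoid.mult = (O), one = Id_on (ends n)\<rparr>"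

lemma group_end_group:
  fixes x :: "nat \<Rightarrow> 'v"
  assumes "n \<ge> 2" "inj_on x {1..2 * n - 1}"
  shows "group (end_group n x)"
proof (rule groupI)
  fix g h k assume g: "g \<in> carrier (end_group n x)"
  then have b: "bij_rel (ends n) g" using realizes_bij_rel[OF assms] by (auto simp: end_group_def)
  show "\<one>\<^bsub>end_group n x\<^esub> \<otimes>\<^bsub>end_group n x\<^esub> g = g" using bij_rel_comp_Id_on[OF b] by (simp add: end_group_def)
  have "g\<inverse> \<in> carrier (end_group n x)" using g realizes_converse[OF assms] by (force simp: end_group_def)
  moreover have "g\<inverse> \<otimes>\<^bsub>end_group n x\<^esub> g = \<one>\<^bsub>end_group n x\<^esub>"
    using bij_rel_converse_comp[OF b] by (simp add: end_group_def)
  ultimately show "\<exists>h\<in>carrier (end_group n x). h \<otimes>\<^bsub>end_group n x\<^esub> g = \<one>\<^bsub>end_group n x\<^esub>" by blast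
  show "g \<otimes>\<^bsub>end_group n x\<^esub> h \<in> carrier (end_group n x)" if "h \<in> carrier (end_group n x)"
    using g that realizes.comp by (fastforce simp: end_group_def)
  show "(g \<otimes>\<^bsub>end_group n x\<^esub> h) \<otimes>\<^bsub>end_group n x\<^esub> k = g \<otimes>\<^bsub>end_group n x\<^esub> (h \<otimes>\<^bsub>end_group n x\<^esub> k)"
    by (auto simp: end_group_def O_assoc)
next
  show "\<one>\<^bsub>end_group n x\<^esub> \<in> carrier (end_group n x)"
    using realizes.ident by (force simp: end_group_def)
qed

text \<open>Both groups of the theorem consist of the fibres of a surjection \<open>K\<close> onto
  \<open>end_group\<close>, each with its own formula for products of classes. Sending
  \<open>h\<close> to its fibre is an isomorphism, and it carries the group axioms over as well, so
  that these need no separate proof.\<close>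

lemma group_iso_of_fibres:
  assumes H: "group H" and K: "K ` S = carrier H"
    and car: "carrier G = (\<lambda>h. {a \<in> S. K a = h}) ` carrier H"
    and one: "one G = {a \<in> S. K a = \<one>\<^bsub>H\<^esub>}"
    and mult: "\<And>h k. h \<in> carrier H \<Longrightarrow> k \<in> carrier H \<Longrightarrow>
      {a \<in> S. K a = h} \<otimes>\<^bsub>G\<^esub> {a \<in> S. K a = k} = {a \<in> S. K a = h \<otimes>\<^bsub>H\<^esub> k}"
  shows "group G" "H \<cong> G"
proof -
  let ?F = "\<lambda>h. {a \<in> S. K a = h}"
  have "?F \<in> hom H G" using car mult by (auto simp: hom_def)
  moreover have "bij_betw ?F (carrier H) (carrier G)"
    unfolding bij_betw_def
  proof
    show "inj_on ?F (carrier H)"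
    proof (rule inj_onI)
      fix h k assume h: "h \<in> carrier H" and eq: "?F h = ?F k"
      obtain a where "a \<in> ?F h" using h unfolding K[symmetric] by blast
      moreover from this have "a \<in> ?F k" by (simp only: eq)
      ultimately show "h = k" by simp
    qed
  qed (simp add: car)
  ultimately have iso: "?F \<in> iso H G" by (simp add: iso_def)
  then show "H \<cong> G" by (auto simp: is_iso_def)
  \<comment> \<open>The general fact yields a group whose unit is reset to the image of the unit; by
    \<open>one\<close> this changes nothing.\<close>
  have "group (G\<lparr>one := ?F \<one>\<^bsub>H\<^esub>\<rparr>)" using group.iso_imp_img_group[OF H iso] .
  moreover have "G\<lparr>one := ?F \<one>\<^bsub>H\<^esub>\<rparr> = G" using one by (cases G) simp
  ultimately show "group G" by simp
qed

lemma group_Struct_G: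
  fixes x :: "nat \<Rightarrow> 'v"
  assumes "n \<ge> 2" "inj_on x {1..2 * n - 1}"
  shows "group (Struct_G n x)" "end_group n x \<cong> Struct_G n x"
proof -
  define K where "K f = (THE g. (f, g) \<in> realizes n x)" for f
  have K: "K f = g" if "(f, g) \<in> realizes n x" for f g
    unfolding K_def by (rule the_equality) (use that realizes_functional[OF assms] in blast)+
  let ?S = "Struct_carrier n x"
  have RK: "(f, g) \<in> realizes n x \<longleftrightarrow> f \<in> ?S \<and> K f = g" for f g
  proof
    assume "(f, g) \<in> realizes n x"
    then show "f \<in> ?S \<and> K f = g" using K[of f g] Struct_carrier_iff[of f n x] by blast
  next
    assume f: "f \<in> ?S \<and> K f = g"
    then obtain g' where "(f, g') \<in> realizes n x" using Struct_carrier_iff[of f n x] by blast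
    then show "(f, g) \<in> realizes n x" using K[of f g'] f by simp
  qed
  have cong: "idem_cong (Struct n x) = {(f, f'). f \<in> ?S \<and> f' \<in> ?S \<and> K f = K f'}"
    unfolding idem_cong_Struct[OF assms] RK by auto
  have KS: "K ` ?S = carrier (end_group n x)"
    by (auto simp: end_group_def RK Range_iff)
  have cls: "idem_cong (Struct n x) `` {f} = {a \<in> ?S. K a = K f}" if "f \<in> ?S" for f
    using that unfolding cong by auto
  have Kmult: "K (f O f') = K f O K f'" "f O f' \<in> ?S" if "f \<in> ?S" "f' \<in> ?S" for f f'
    using realizes.comp[of f "K f" n x f' "K f'"] that unfolding RK by simp_all
  have car: "carrier (Struct_G n x) = (\<lambda>h. {a \<in> ?S. K a = h}) ` carrier (end_group n x)"
    unfolding KS[symmetric] using cls by (auto simp: Struct_G_def universal_group_def quotient_def Struct_def)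
  have one: "one (Struct_G n x) = {a \<in> ?S. K a = \<one>\<^bsub>end_group n x\<^esub>}"
  proof -
    have "Id_on (trms n) \<in> ?S" "K (Id_on (trms n)) = Id_on (ends n)"
      using realizes.ident[of n x] unfolding RK by simp_all
    then show ?thesis using cls by (simp add: Struct_G_def universal_group_def Struct_def end_group_def)
  qed
  have mult: "{a \<in> ?S. K a = h} \<otimes>\<^bsub>Struct_G n x\<^esub> {a \<in> ?S. K a = k} = {a \<in> ?S. K a = h \<otimes>\<^bsub>end_group n x\<^esub> k}"
    if hk: "h \<in> carrier (end_group n x)" "k \<in> carrier (end_group n x)" for h k
  proof -
    obtain f f' where f: "f \<in> ?S" "K f = h" "f' \<in> ?S" "K f' = k" using hk unfolding KS[symmetric] by blast
    \<comment> \<open>All representatives give the same class, so the union in the product is this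
      class as soon as both fibres are nonempty.\<close>
    have "idem_cong (Struct n x) `` {a O b} = {c \<in> ?S. K c = h O k}"
      if "a \<in> {a \<in> ?S. K a = h}" "b \<in> {a \<in> ?S. K a = k}" for a b
      using that cls Kmult by auto
    then have "(\<Union>a\<in>{a \<in> ?S. K a = h}. \<Union>b\<in>{a \<in> ?S. K a = k}. idem_cong (Struct n x) `` {a O b}) = {c \<in> ?S. K c = h O k}"
      using f by blast
    then show ?thesis by (simp add: Struct_G_def universal_group_def Struct_def end_group_def)
  qed
  show "group (Struct_G n x)" "end_group n x \<cong> Struct_G n x"
    using group_iso_of_fibres[OF group_end_group[OF assms] KS car one mult] by simp_all
qed

subsection \<open>Complete prefix codes\<close>

lemma shift_prefix: "p @- w = q @- z \<Longrightarrow> length p \<le> length q \<Longrightarrow> \<exists>r. q = p @ r \<and> w = r @- z"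
proof (induction p arbitrary: q)
  case (Cons a p)
  then show ?case by (cases q) auto
qed simp

text \<open>For \<open>n \<ge> 2\<close> these are exactly the leaf sets of the \<open>n\<close>-ary
  trees, by \<open>complete_code_leaves\<close> and \<open>tree_of_complete_code\<close>. Described
  by their cones, they can be contracted and mapped by permutations without any recursion over
  trees.\<close>

definition complete_code :: "nat \<Rightarrow> nat list set \<Rightarrow> bool" where
  "complete_code n C \<longleftrightarrow> finite C \<and> C \<subseteq> lists {1..n} \<and> (\<forall>z\<in>ends n. \<exists>l\<in>C. \<exists>w. z = l @- w) \<and>
     (\<forall>l\<in>C. \<forall>l'\<in>C. \<forall>w w'. l @- w = l' @- w' \<longrightarrow> l = l')"

lemma complete_codeD:
  assumes "complete_code n C"
  shows "finite C" "l \<in> C \<Longrightarrow> l \<in> lists {1..n}"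
    "l \<in> C \<Longrightarrow> l' \<in> C \<Longrightarrow> l @- w = l' @- w' \<Longrightarrow> l = l'"
  using assms unfolding complete_code_def by blast+

lemma complete_code_cover:
  assumes "complete_code n C" "z \<in> ends n"
  shows "\<exists>l\<in>C. \<exists>w\<in>ends n. z = l @- w"
proof -
  obtain l w where "l \<in> C" "z = l @- w" using assms unfolding complete_code_def by blast
  then show ?thesis using assms(2) by auto
qed

lemma complete_code_prefix: "complete_code n C \<Longrightarrow> l \<in> C \<Longrightarrow> l @ r \<in> C \<Longrightarrow> r = []"
  \<comment> \<open>Any stream serves as the tail, because prefix-freeness is stated for all streams
    and not only for ends.\<close>
  using complete_codeD(3)[of n C l "l @ r" "r @- sconst 0" "sconst 0"] by simp

lemma complete_code_Nil: "complete_code n {[]}"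
  by (auto simp: complete_code_def)

lemma complete_code_with_Nil: "complete_code n C \<Longrightarrow> [] \<in> C \<Longrightarrow> C = {[]}"
  using complete_code_prefix[of n C "[]"] by fastforce

lemma complete_code_nonempty: "complete_code n C \<Longrightarrow> n > 0 \<Longrightarrow> C \<noteq> {}"
  using sconst_in_ends[of 1 n] complete_code_cover by fastforce

abbreviation children :: "nat \<Rightarrow> nat list \<Rightarrow> nat list set" where
  "children n l \<equiv> (\<lambda>i. l @ [i]) ` {1..n}"

lemma children_disjoint:
  assumes "complete_code n C" "l \<in> C"
  shows "C \<inter> children n l = {}"
  using complete_code_prefix[OF assms] by blast

text \<open>Written additively to stay clear of truncated subtraction. It makes the cardinality a
  measure for inductions by contraction.\<close>

lemma card_expand:
  assumes "complete_code n C" "l \<in> C"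
  shows "card (C - {l} \<union> children n l) + 1 = card C + n"
proof -
  have "card (children n l) = n" by (subst card_image) (auto simp: inj_on_def)
  moreover have "card (C - {l}) + 1 = card C"
    using complete_codeD(1)[OF assms(1)] assms(2) by (metis Suc_eq_plus1 card_Suc_Diff1)
  moreover have "card (C - {l} \<union> children n l) = card (C - {l}) + card (children n l)"
    using children_disjoint[OF assms] complete_codeD(1)[OF assms(1)] by (intro card_Un_disjoint) auto
  ultimately show ?thesis by simp
qed

text \<open>Take a longest word \<open>m = l @ [i]\<close>. Some word of the code covers an end that
  begins with \<open>l @ [j]\<close>. It is no prefix of \<open>l\<close>, since it would then be a
  proper prefix of \<open>m\<close>, and it is no longer than \<open>m\<close>; so it equals
  \<open>l @ [j]\<close>. All children of \<open>l\<close> therefore belong to the code and may be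
  replaced by \<open>l\<close>.\<close>

lemma complete_code_contract:
  assumes C: "complete_code n C" "C \<noteq> {[]}" and n: "n > 0"
  shows "\<exists>D l. complete_code n D \<and> l \<in> D \<and> C = D - {l} \<union> children n l"
proof -
  have fin: "finite C" "C \<noteq> {}" using complete_codeD(1) complete_code_nonempty C n by blast+
  then have "Max (length ` C) \<in> length ` C" by (intro Max_in) auto
  then obtain m where m: "m \<in> C" "length m = Max (length ` C)" by auto
  have mx: "length k \<le> length m" if "k \<in> C" for k using that fin m(2) by simp
  have "m \<noteq> []" using m(1) complete_code_with_Nil C by blast
  then obtain l i where li: "m = l @ [i]" by (cases m rule: rev_cases) auto
  have mw: "m \<in> lists {1..n}" using complete_codeD(2)[OF C(1) m(1)] .
  have npre: "l' \<notin> C" if "l = l' @ r" for l' r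
    using complete_code_prefix[OF C(1), of l' "r @ [i]"] m(1) li that by auto
  have ch: "l @ [j] \<in> C" if j: "j \<in> {1..n}" for j
  proof -
    have "(l @ [j]) @- sconst j \<in> ends n" using mw li j sconst_in_ends[OF j] by auto
    then obtain l' w where l': "l' \<in> C" "(l @ [j]) @- sconst j = l' @- w" using complete_code_cover[OF C(1)] by blast
    show ?thesis
    proof (cases "length l' \<le> length l")
      case True
      have "l' @- w = l @- (j ## sconst j)" using l'(2) by simp
      then obtain r where "l = l' @ r" using shift_prefix True by blast
      then show ?thesis using npre l'(1) by blast
    next
      case False
      then have "length (l @ [j]) = length l'" using mx[OF l'(1)] li by simp
      then show ?thesis using shift_same_length l' by blast
    qed
  qed
  have lC: "l \<notin> C" using npre[of l "[]"] by simp
  \<comment> \<open>No remaining word meets the cone of \<open>l\<close>: it would be a prefix of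
    \<open>l\<close>, or, as \<open>m\<close> is longest, a child of \<open>l\<close>.\<close>
  have new: "l = k" if k: "k \<in> C - children n l" and eq: "l @- w = k @- w'" for k w w'
  proof (cases "length k \<le> length l")
    case True
    then obtain r where "l = k @ r" using shift_prefix eq by metis
    then show ?thesis using npre k by blast
  next
    case False
    then obtain r where r: "k = l @ r" using shift_prefix[OF eq] by auto
    then have "length r = 1" using False mx[of k] k li r by (cases r) auto
    then obtain j where "k = l @ [j]" using r by (cases r) auto
    moreover have "k \<in> lists {1..n}" using k complete_codeD(2)[OF C(1)] by blast
    ultimately show ?thesis using k by auto
  qed
  let ?D = "insert l (C - children n l)"
  have "complete_code n ?D"
    unfolding complete_code_def
  proof (intro conjI ballI allI impI)
    show "finite ?D" using fin by simp
    show "?D \<subseteq> lists {1..n}" using complete_codeD(2)[OF C(1)] mw li by auto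
  next
    fix z assume "z \<in> ends n"
    then obtain k w where k: "k \<in> C" "z = k @- w" using complete_code_cover[OF C(1)] by blast
    show "\<exists>l\<in>?D. \<exists>w. z = l @- w"
    proof (cases "k \<in> children n l")
      case True
      then obtain j where "k = l @ [j]" by blast
      then have "z = l @- (j ## w)" using k(2) by simp
      then show ?thesis by blast
    qed (use k in blast)
  next
    fix a b w w' assume "a \<in> ?D" "b \<in> ?D" "a @- w = b @- w'"
    then show "a = b" using new[of b w w'] new[of a w' w] complete_codeD(3)[OF C(1), of a b w w'] by auto
  qed
  moreover have "C = ?D - {l} \<union> children n l" using ch lC by auto
  ultimately show ?thesis by blast
qed

section \<open>Trees and their leaf codes\<close>

lemma mem_leaves_Node: "k \<in> leaves (Node ts) \<longleftrightarrow> (\<exists>i l. k = Suc i # l \<and> i < length ts \<and> l \<in> leaves (ts ! i))"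
proof
  assume "k \<in> leaves (Node ts)"
  then obtain j l where "j \<in> {1..length ts}" "k = j # l" "l \<in> map leaves ts ! (j - 1)" by auto
  then show "\<exists>i l. k = Suc i # l \<and> i < length ts \<and> l \<in> leaves (ts ! i)"
    by (intro exI[of _ "j - 1"] exI[of _ l]) auto
next
  assume "\<exists>i l. k = Suc i # l \<and> i < length ts \<and> l \<in> leaves (ts ! i)"
  then obtain i l where "k = Suc i # l" "i < length ts" "l \<in> leaves (ts ! i)" by blast
  then show "k \<in> leaves (Node ts)" by (auto intro!: bexI[of _ "Suc i"])
qed

lemma expand_at_leaves:
  "T \<in> nary_trees n \<Longrightarrow> l \<in> leaves T \<Longrightarrow> expand_at n l T \<in> nary_trees n \<and>
     leaves (expand_at n l T) = leaves T - {l} \<union> children n l"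
proof (induction n l T rule: expand_at.induct)
  case (1 n T)
  then have T: "T = Leaf" by (cases T) auto
  have "i \<in> {1..n} \<Longrightarrow> map leaves (replicate n Leaf) ! (i - 1) = {[]}" for i by auto
  then have "leaves (Node (replicate n Leaf)) = (\<Union>i\<in>{1..n}. {[i]})" by simp
  then show ?case using T by (auto intro!: nary_trees.intros)
next
  case (3 n i l ts)
  then have ts: "length ts = n" "\<And>t. t \<in> set ts \<Longrightarrow> t \<in> nary_trees n" by (auto elim: nary_trees.cases)
  have i: "i \<in> {1..n}" "l \<in> leaves (ts ! (i - 1))" using "3.prems"(2) ts by (auto simp: nth_map)
  then have mem: "ts ! (i - 1) \<in> nary_trees n" using ts by (auto intro!: ts(2) nth_mem)
  let ?t = "expand_at n l (ts ! (i - 1))"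
  have IH: "?t \<in> nary_trees n" "leaves ?t = leaves (ts ! (i - 1)) - {l} \<union> children n l"
    using "3.IH" mem i by auto
  have eq: "k \<in> leaves (Node (ts[i - 1 := ?t])) \<longleftrightarrow> k \<in> leaves (Node ts) - {i # l} \<union> children n (i # l)" for k
  proof (cases k)
    case (Cons j k')
    have mem: "j # k' \<in> leaves (Node us) \<longleftrightarrow> j \<in> {1..length us} \<and> k' \<in> leaves (us ! (j - 1))" for us
      unfolding mem_leaves_Node by (cases j) auto
    show ?thesis
    proof (cases "j = i")
      case True
      then show ?thesis unfolding Cons Un_iff Diff_iff mem using i ts IH by auto
    next
      case False
      moreover have "ts[i - 1 := ?t] ! (j - 1) = ts ! (j - 1)" if "j \<in> {1..n}"
        using that False i by (auto simp: nth_list_update)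
      ultimately show ?thesis unfolding Cons Un_iff Diff_iff mem using ts by auto
    qed
  qed auto
  have "leaves (Node (ts[i - 1 := ?t])) = leaves (Node ts) - {i # l} \<union> children n (i # l)"
    by (rule Set.set_eqI[OF eq])
  moreover have "Node (ts[i - 1 := ?t]) \<in> nary_trees n"
    using ts IH(1) by (auto intro!: nary_trees.Node dest!: subsetD[OF set_update_subset_insert])
  ultimately show ?case unfolding expand_at.simps by (intro conjI)
qed auto

lemma complete_code_leaves: "T \<in> nary_trees n \<Longrightarrow> complete_code n (leaves T)"
proof (induction rule: nary_trees.induct)
  case Leaf
  show ?case by (simp add: complete_code_Nil)
next
  case (Node ts)
  have IH: "complete_code n (leaves (ts ! i))" if "i < n" for i using Node that by auto
  show ?case
    unfolding complete_code_def
  proof (intro conjI ballI allI impI)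
    have "finite (map leaves ts ! (i - 1))" if "i \<in> {1..length ts}" for i
      using complete_codeD(1)[OF IH[of "i - 1"]] that Node.hyps by auto
    then show "finite (leaves (Node ts))" by simp
    show "leaves (Node ts) \<subseteq> lists {1..n}"
    proof
      fix k assume "k \<in> leaves (Node ts)"
      then obtain i l where "k = Suc i # l" "i < length ts" "l \<in> leaves (ts ! i)"
        unfolding mem_leaves_Node by blast
      then show "k \<in> lists {1..n}" using complete_codeD(2)[OF IH[of i], of l] Node.hyps by auto
    qed
  next
    fix z assume "z \<in> ends n"
    then obtain i z' where z: "z = Suc i ## z'" "z' \<in> ends n" "i < n" by (cases z; cases "shd z") auto
    then obtain l w where "l \<in> leaves (ts ! i)" "z' = l @- w" using complete_code_cover[OF IH] by blast
    then have "Suc i # l \<in> leaves (Node ts)" "z = (Suc i # l) @- w"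
      using z Node.hyps unfolding mem_leaves_Node by auto
    then show "\<exists>l\<in>leaves (Node ts). \<exists>w. z = l @- w" by blast
  next
    fix k k' w w' assume k: "k \<in> leaves (Node ts)" "k' \<in> leaves (Node ts)" "k @- w = k' @- w'"
    obtain i l where 1: "k = Suc i # l" "i < n" "l \<in> leaves (ts ! i)" using k(1) Node.hyps unfolding mem_leaves_Node by auto
    obtain j l' where 2: "k' = Suc j # l'" "j < n" "l' \<in> leaves (ts ! j)" using k(2) Node.hyps unfolding mem_leaves_Node by auto
    have "i = j" "l @- w = l' @- w'" using k(3) 1 2 by auto
    then show "k = k'" using 1 2 complete_codeD(3)[OF IH[of i], of l l' w w'] by simp
  qed
qed

lemma leaves_inj:
  assumes "T \<in> nary_trees n" "T' \<in> nary_trees n" "leaves T = leaves T'"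
  shows "T = T'"
  using assms
proof (induction arbitrary: T')
  case Leaf
  then show ?case by (cases T') auto
next
  case (Node ts)
  obtain ts' where T': "T' = Node ts'"
    using Node.prems(2) mem_leaves_Node[of "[]" ts] by (cases T') auto
  then have ts': "length ts' = n" "\<And>t. t \<in> set ts' \<Longrightarrow> t \<in> nary_trees n"
    using Node.prems(1) by (auto elim: nary_trees.cases)
  have "ts ! i = ts' ! i" if i: "i < n" for i
  proof (rule Node.IH)
    show "ts ! i \<in> set ts" "ts' ! i \<in> nary_trees n" using i ts' Node.hyps by auto
    have a: "l \<in> leaves (ts ! i) \<longleftrightarrow> Suc i # l \<in> leaves (Node ts)" for l
      unfolding mem_leaves_Node using i Node.hyps by auto
    have b: "l \<in> leaves (ts' ! i) \<longleftrightarrow> Suc i # l \<in> leaves (Node ts')" for l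
      unfolding mem_leaves_Node using i ts' by auto
    have "leaves (Node ts) = leaves (Node ts')" using Node.prems(2) T' by (simp only:)
    then show "leaves (ts ! i) = leaves (ts' ! i)"
      by (intro Set.set_eqI) (simp only: a b)
  qed
  then show ?case using T' ts' Node.hyps by (auto intro: nth_equalityI)
qed

text \<open>Contract siblings, take the tree of the smaller code and expand it again; for
  \<open>n \<ge> 2\<close> a contraction strictly lowers the cardinality.\<close>

lemma tree_of_complete_code:
  assumes "complete_code n C" "n \<ge> 2"
  shows "\<exists>T\<in>nary_trees n. leaves T = C"
  using assms(1)
proof (induction "card C" arbitrary: C rule: less_induct)
  case less
  show ?case
  proof (cases "C = {[]}")
    case True
    then show ?thesis using nary_trees.Leaf by (metis leaves.simps(1))
  next
    case False
    then obtain D l where D: "complete_code n D" "l \<in> D" "C = D - {l} \<union> children n l"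
      using complete_code_contract less.prems assms(2) by (metis gr0I not_numeral_le_zero)
    then have "card D < card C" using card_expand[OF D(1,2)] assms(2) by simp
    then obtain T where "T \<in> nary_trees n" "leaves T = D" using less.hyps D(1) by blast
    then show ?thesis using expand_at_leaves[of T n l] D by blast
  qed
qed

section \<open>The action of a bijection between codes\<close>

definition code_rel :: "nat \<Rightarrow> nat list set \<Rightarrow> (nat list \<Rightarrow> nat list) \<Rightarrow> (nat stream \<times> nat stream) set" where
  "code_rel n C \<sigma> = {(l @- w, \<sigma> l @- w) | l w. l \<in> C \<and> w \<in> ends n}"

lemma maps_cone_code_rel: "l \<in> C \<Longrightarrow> maps_cone n (code_rel n C \<sigma>) l (\<sigma> l)"
  by (auto simp: maps_cone_def code_rel_def)

text \<open>Together with \<open>bij_rel_eqI\<close> this reduces an equality of permutations to one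
  check per word of a code.\<close>

lemma code_rel_subsetI:
  "(\<And>l. l \<in> C \<Longrightarrow> maps_cone n g l (\<sigma> l)) \<Longrightarrow> code_rel n C \<sigma> \<subseteq> g"
  by (auto simp: maps_cone_def code_rel_def)

lemma bij_rel_code_rel:
  assumes C: "complete_code n C" and D: "complete_code n D" and \<sigma>: "bij_betw \<sigma> C D"
  shows "bij_rel (ends n) (code_rel n C \<sigma>)"
proof (rule bij_relI)
  have D': "\<sigma> l \<in> D" if "l \<in> C" for l using \<sigma> that by (auto simp: bij_betw_def)
  show "code_rel n C \<sigma> \<subseteq> ends n \<times> ends n"
    using complete_codeD(2)[OF C] complete_codeD(2)[OF D] D' unfolding code_rel_def by auto
  show "\<exists>b. (a, b) \<in> code_rel n C \<sigma>" if "a \<in> ends n" for a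
    using complete_code_cover[OF C that] unfolding code_rel_def by blast
  show "\<exists>a. (a, b) \<in> code_rel n C \<sigma>" if b: "b \<in> ends n" for b
  proof -
    obtain k w where "k \<in> D" "w \<in> ends n" "b = k @- w" using complete_code_cover[OF D b] by blast
    moreover from this obtain l where "l \<in> C" "\<sigma> l = k" using \<sigma> by (auto simp: bij_betw_def)
    ultimately show ?thesis unfolding code_rel_def by blast
  qed
  show "b = c" if bc: "(a, b) \<in> code_rel n C \<sigma>" "(a, c) \<in> code_rel n C \<sigma>" for a b c
  proof -
    obtain l w where 1: "l \<in> C" "a = l @- w" "b = \<sigma> l @- w" using bc(1) unfolding code_rel_def by blast
    obtain l' w' where 2: "l' \<in> C" "a = l' @- w'" "c = \<sigma> l' @- w'" using bc(2) unfolding code_rel_def by blast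
    have "l = l'" using complete_codeD(3)[OF C] 1 2 by blast
    then show ?thesis using 1 2 by simp
  qed
  show "a = b" if bc: "(a, c) \<in> code_rel n C \<sigma>" "(b, c) \<in> code_rel n C \<sigma>" for a b c
  proof -
    obtain l w where 1: "l \<in> C" "a = l @- w" "c = \<sigma> l @- w" using bc(1) unfolding code_rel_def by blast
    obtain l' w' where 2: "l' \<in> C" "b = l' @- w'" "c = \<sigma> l' @- w'" using bc(2) unfolding code_rel_def by blast
    have "\<sigma> l = \<sigma> l'" using complete_codeD(3)[OF D] 1 2 D' by blast
    then have "l = l'" using \<sigma> 1 2 by (auto simp: bij_betw_def inj_on_def)
    then show ?thesis using 1 2 by simp
  qed
qed

subsection \<open>Generation by cone exchanges\<close>

definition incomparable :: "nat list \<Rightarrow> nat list \<Rightarrow> bool" where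
  "incomparable u v \<longleftrightarrow> (\<forall>w w'. u @- w \<noteq> v @- w')"

definition cone_swap :: "nat \<Rightarrow> nat list \<Rightarrow> nat list \<Rightarrow> (nat stream \<times> nat stream) set" where
  "cone_swap n u v = {(u @- w, v @- w) | w. w \<in> ends n} \<union> {(v @- w, u @- w) | w. w \<in> ends n} \<union>
     {(z, z) | z. z \<in> ends n \<and> (\<forall>w. z \<noteq> u @- w) \<and> (\<forall>w. z \<noteq> v @- w)}"

lemma incomparable_branch: "i \<noteq> j \<Longrightarrow> incomparable (p @ i # u) (p @ j # v)"
  by (simp add: incomparable_def)

text \<open>Follow both words up to the first difference. Neither can end before it, since a prefix
  shares a stream with each of its extensions; any tail, here \<open>sconst 0\<close>, exhibits such
  a stream.\<close>

lemma incomparableD: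
  assumes "incomparable u v"
  shows "\<exists>p i j u' v'. i \<noteq> j \<and> u = p @ i # u' \<and> v = p @ j # v'"
  using assms
proof (induction u arbitrary: v)
  case Nil
  then have "[] @- (v @- sconst 0) \<noteq> v @- sconst 0" unfolding incomparable_def by blast
  then show ?case by simp
next
  case (Cons a u)
  have "(a # u) @- sconst 0 \<noteq> v @- ((a # u) @- sconst 0)" using Cons.prems unfolding incomparable_def by blast
  then obtain b v' where v: "v = b # v'" by (cases v) auto
  show ?case
  proof (cases "a = b")
    case True
    then have "incomparable u v'" using Cons.prems v by (simp add: incomparable_def)
    then obtain p i j u' v'' where "i \<noteq> j" "u = p @ i # u'" "v' = p @ j # v''" using Cons.IH by blast
    then show ?thesis using v True by (metis append_Cons)
  next
    case False
    then show ?thesis using v by (metis append_Nil)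
  qed
qed

lemma cone_swap_sym: "cone_swap n u v = cone_swap n v u"
  unfolding cone_swap_def by blast

lemma bij_rel_cone_swap:
  assumes uv: "u \<in> lists {1..n}" "v \<in> lists {1..n}" "incomparable u v"
  shows "bij_rel (ends n) (cone_swap n u v)"
proof (rule bij_relI)
  have sym: "(b, a) \<in> cone_swap n u v" if "(a, b) \<in> cone_swap n u v" for a b
    using that unfolding cone_swap_def by blast
  have total: "\<exists>b. (a, b) \<in> cone_swap n u v" if "a \<in> ends n" for a
  proof -
    consider w where "a = u @- w" | w where "a = v @- w" | "\<forall>w. a \<noteq> u @- w" "\<forall>w. a \<noteq> v @- w" by blast
    then show ?thesis
    proof cases
      case (1 w)
      then have "w \<in> ends n" using that by simp
      then show ?thesis using 1 unfolding cone_swap_def by blast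
    next
      case (2 w)
      then have "w \<in> ends n" using that by simp
      then show ?thesis using 2 unfolding cone_swap_def by blast
    next
      case 3
      then show ?thesis using that unfolding cone_swap_def by blast
    qed
  qed
  have fn: "b = c" if "(a, b) \<in> cone_swap n u v" "(a, c) \<in> cone_swap n u v" for a b c
    using that uv(3) unfolding cone_swap_def incomparable_def by auto
  show "cone_swap n u v \<subseteq> ends n \<times> ends n" using uv unfolding cone_swap_def by auto
  show "\<exists>b. (a, b) \<in> cone_swap n u v" if "a \<in> ends n" for a using total that .
  show "\<exists>b. (b, a) \<in> cone_swap n u v" if "a \<in> ends n" for a using total that sym by blast
  show "b = c" if "(a, b) \<in> cone_swap n u v" "(a, c) \<in> cone_swap n u v" for a b c using fn that .
  show "a = b" if "(a, c) \<in> cone_swap n u v" "(b, c) \<in> cone_swap n u v" for a b c using fn that sym by blast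
qed

lemma maps_cone_swap: "maps_cone n (cone_swap n u v) u v"
  by (auto simp: maps_cone_def cone_swap_def)

lemma maps_cone_swap': "maps_cone n (cone_swap n u v) v u"
  by (auto simp: maps_cone_def cone_swap_def)

lemma maps_cone_swap_fixed:
  "w \<in> lists {1..n} \<Longrightarrow> incomparable w u \<Longrightarrow> incomparable w v \<Longrightarrow> maps_cone n (cone_swap n u v) w w"
  by (auto simp: maps_cone_def cone_swap_def incomparable_def)

lemma maps_cone_append: "maps_cone n g p q \<Longrightarrow> r \<in> lists {1..n} \<Longrightarrow> maps_cone n g (p @ r) (q @ r)"
  by (simp add: maps_cone_def)

lemma maps_cone_converse: "maps_cone n g p q \<Longrightarrow> maps_cone n (g\<inverse>) q p"
  by (auto simp: maps_cone_def)

text \<open>As for transpositions in a symmetric group, conjugation by \<open>g\<close> renames what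
  is exchanged. All new exchanges below are obtained from old ones in this way.\<close>

lemma cone_swap_conj:
  assumes g: "bij_rel (ends n) g" "maps_cone n g u u'" "maps_cone n g v v'"
    and w: "u \<in> lists {1..n}" "v \<in> lists {1..n}" "incomparable u v"
      "u' \<in> lists {1..n}" "v' \<in> lists {1..n}" "incomparable u' v'"
  shows "g\<inverse> O cone_swap n u v O g = cone_swap n u' v'"
proof (rule bij_rel_eqI)
  show "bij_rel (ends n) (g\<inverse> O cone_swap n u v O g)"
    by (intro bij_rel_comp bij_rel_converse bij_rel_cone_swap g w)
  show "bij_rel (ends n) (cone_swap n u' v')" by (intro bij_rel_cone_swap w)
  show "g\<inverse> O cone_swap n u v O g \<subseteq> cone_swap n u' v'"
  proof (rule subrelI)
    fix y z assume "(y, z) \<in> g\<inverse> O cone_swap n u v O g"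
    then obtain a b where ab: "(a, y) \<in> g" "(a, b) \<in> cone_swap n u v" "(b, z) \<in> g" by blast
    have fn: "z = z'" if "(a, z) \<in> g" "(a, z') \<in> g" for a z z' using bij_rel_functional[OF g(1) that] .
    have gu: "(u @- w, u' @- w) \<in> g" "(v @- w, v' @- w) \<in> g" if "w \<in> ends n" for w
      using g that unfolding maps_cone_def by blast+
    consider w where "w \<in> ends n" "a = u @- w" "b = v @- w" | w where "w \<in> ends n" "a = v @- w" "b = u @- w"
      | "b = a" "\<forall>w. a \<noteq> u @- w" "\<forall>w. a \<noteq> v @- w" "a \<in> ends n"
      using ab(2) unfolding cone_swap_def by blast
    then show "(y, z) \<in> cone_swap n u' v'"
    proof cases
      case (1 w)
      then have "y = u' @- w" "z = v' @- w" using fn gu ab by blast+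
      then show ?thesis using 1 unfolding cone_swap_def by blast
    next
      case (2 w)
      then have "y = v' @- w" "z = u' @- w" using fn gu ab by blast+
      then show ?thesis using 2 unfolding cone_swap_def by blast
    next
      case 3
      have y: "y = z" "y \<in> ends n" using fn ab 3 bij_rel_subset[OF g(1)] by blast+
      have "y \<noteq> u' @- w" for w
      proof
        assume yw: "y = u' @- w"
        then have "w \<in> ends n" using y by simp
        then have "(u @- w, y) \<in> g" using gu yw by simp
        then have "a = u @- w" using bij_rel_inj[OF g(1) ab(1)] by simp
        then show False using 3 by blast
      qed
      moreover have "y \<noteq> v' @- w" for w
      proof
        assume yw: "y = v' @- w"
        then have "w \<in> ends n" using y by simp
        then have "(v @- w, y) \<in> g" using gu yw by simp
        then have "a = v @- w" using bij_rel_inj[OF g(1) ab(1)] by simp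
        then show False using 3 by blast
      qed
      ultimately show ?thesis using y unfolding cone_swap_def by blast
    qed
  qed
qed

lemma code_incomparable:
  "complete_code n C \<Longrightarrow> a \<in> C \<Longrightarrow> b \<in> C \<Longrightarrow> a \<noteq> b \<Longrightarrow> incomparable a b"
  using complete_codeD(3) unfolding incomparable_def by blast

lemma code_rel_cong:
  assumes "\<And>l. l \<in> C \<Longrightarrow> \<sigma> l = \<tau> l"
  shows "code_rel n C \<sigma> = code_rel n C \<tau>"
proof
  show "code_rel n C \<sigma> \<subseteq> code_rel n C \<tau>"
    by (rule code_rel_subsetI) (simp add: assms maps_cone_code_rel)
  show "code_rel n C \<tau> \<subseteq> code_rel n C \<sigma>"
    by (rule code_rel_subsetI) (simp add: assms[symmetric] maps_cone_code_rel)
qed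

lemma code_rel_id:
  assumes "complete_code n C"
  shows "code_rel n C (\<lambda>l. l) = Id_on (ends n)"
proof (rule bij_rel_eqI[OF bij_rel_code_rel[OF assms assms] bij_rel_Id_on])
  show "bij_betw (\<lambda>l. l) C C" by (simp add: bij_betw_def)
  show "code_rel n C (\<lambda>l. l) \<subseteq> Id_on (ends n)"
    using complete_codeD(2)[OF assms] by (auto simp: code_rel_def)
qed

lemma code_rel_comp:
  assumes "complete_code n C" "complete_code n D" "complete_code n E" "bij_betw \<sigma> C D" "bij_betw \<tau> D E"
  shows "code_rel n C \<sigma> O code_rel n D \<tau> = code_rel n C (\<tau> \<circ> \<sigma>)"
proof (rule bij_rel_eqI[symmetric])
  show "bij_rel (ends n) (code_rel n C \<sigma> O code_rel n D \<tau>)"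
    by (rule bij_rel_comp) (rule bij_rel_code_rel, fact+)+
  show "bij_rel (ends n) (code_rel n C (\<tau> \<circ> \<sigma>))"
    by (rule bij_rel_code_rel[OF assms(1,3) bij_betw_trans[OF assms(4,5)]])
  show "code_rel n C (\<tau> \<circ> \<sigma>) \<subseteq> code_rel n C \<sigma> O code_rel n D \<tau>"
  proof (rule code_rel_subsetI)
    fix l assume l: "l \<in> C"
    then have "\<sigma> l \<in> D" using assms(4) by (auto simp: bij_betw_def)
    then have "maps_cone n (code_rel n D \<tau>) (\<sigma> l) (\<tau> (\<sigma> l))" by (rule maps_cone_code_rel)
    then show "maps_cone n (code_rel n C \<sigma> O code_rel n D \<tau>) l ((\<tau> \<circ> \<sigma>) l)"
      using maps_cone_comp[OF maps_cone_code_rel[OF l]] by simp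
  qed
qed

lemma code_rel_transpose:
  assumes C: "complete_code n C" and ab: "a \<in> C" "b \<in> C" "a \<noteq> b"
  shows "code_rel n C (transpose a b) = cone_swap n a b"
proof (rule bij_rel_eqI[OF bij_rel_code_rel[OF C C] bij_rel_cone_swap])
  show "bij_betw (transpose a b) C C" using ab by (simp add: bij_betw_def)
  show "a \<in> lists {1..n}" "b \<in> lists {1..n}" using complete_codeD(2)[OF C] ab by blast+
  show "incomparable a b" using code_incomparable C ab by blast
  show "code_rel n C (transpose a b) \<subseteq> cone_swap n a b"
  proof (rule code_rel_subsetI)
    fix l assume l: "l \<in> C"
    consider "l = a" | "l = b" | "l \<noteq> a" "l \<noteq> b" by blast
    then show "maps_cone n (cone_swap n a b) l (transpose a b l)"
    proof cases
      case 3
      then have "incomparable l a" "incomparable l b" using code_incomparable C ab l by blast+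
      then show ?thesis using maps_cone_swap_fixed[OF complete_codeD(2)[OF C l]] 3 by simp
    qed (simp_all add: maps_cone_swap maps_cone_swap')
  qed
qed

section \<open>Exchanges supplied by the equations\<close>

lemma nth_vars: "k < Suc j - i \<Longrightarrow> vars x i j ! k = Var (x (i + k))"
  unfolding vars_def by (simp del: upt_Suc)

context
  fixes n :: nat and x :: "nat \<Rightarrow> 'v"
  assumes n2: "n \<ge> 2" and inj: "inj_on x {1..2 * n - 1}"
begin

lemma end_perms_comp: "g \<in> end_perms n x \<Longrightarrow> h \<in> end_perms n x \<Longrightarrow> g O h \<in> end_perms n x"
  using realizes.comp[of _ g n x _ h] by blast

lemma end_perms_converse: "g \<in> end_perms n x \<Longrightarrow> g\<inverse> \<in> end_perms n x"
  using realizes_converse[OF n2 inj] by blast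

lemma end_perms_Id_on: "Id_on (ends n) \<in> end_perms n x"
  using realizes.ident by blast

lemma end_perms_bij_rel: "g \<in> end_perms n x \<Longrightarrow> bij_rel (ends n) g"
  using realizes_bij_rel[OF n2 inj] by blast

lemma end_perms_conj:
  assumes "g \<in> end_perms n x" "cone_swap n u v \<in> end_perms n x" "maps_cone n g u u'" "maps_cone n g v v'"
    and "u \<in> lists {1..n}" "v \<in> lists {1..n}" "incomparable u v" "u' \<in> lists {1..n}" "v' \<in> lists {1..n}" "incomparable u' v'"
  shows "cone_swap n u' v' \<in> end_perms n x"
proof -
  have "g\<inverse> O cone_swap n u v O g \<in> end_perms n x" by (intro end_perms_comp end_perms_converse assms(1,2))
  then show ?thesis using cone_swap_conj[OF end_perms_bij_rel[OF assms(1)] assms(3-10)] by simp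
qed

text \<open>The symmetry equation at \<open>p\<close> exchanges two neighbouring arguments, hence
  the cones of two neighbouring children of \<open>p\<close>.\<close>

lemma swap_adjacent:
  assumes p: "p \<in> lists {1..n}" and i: "1 \<le> i" "i < n"
  shows "cone_swap n (p @ [i]) (p @ [i + 1]) \<in> end_perms n x"
proof -
  define ss tt where "ss = vars x 1 (i - 1) @ [Var (x i), Var (x (i + 1))] @ vars x (i + 2) n"
    and "tt = vars x 1 (i - 1) @ [Var (x (i + 1)), Var (x i)] @ vars x (i + 2) n"
  have st: "(Op ss, Op tt) \<in> SC_equations n x" using i unfolding SC_equations_def ss_def tt_def by blast
  let ?g = "match_rel n (Op ss) (Op tt)"
  have g: "act_below n p ?g \<in> end_perms n x" using realizes.gen[of "Op ss" "Op tt" n x p] st p by blast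
  have "[i..<Suc n] = [i, i + 1] @ [i + 2..<Suc n]" using i by (simp add: upt_conv_Cons del: upt_Suc)
  then have upt: "[1..<Suc n] = [1..<i] @ [i, i + 1] @ [i + 2..<Suc n]"
    using upt_append[of 1 i "Suc n"] i by (simp del: upt_Suc)
  have ss: "ss = map (\<lambda>k. Var (x k)) [1..<Suc n]"
    unfolding ss_def vars_def upt using i by (simp del: upt_Suc)
  \<comment> \<open>Writing the right-hand side as a reindexed copy of the left one makes the leaf
    matching send child \<open>k\<close> to child \<open>transpose i (i + 1) k\<close>.\<close>
  have tt: "tt = map (\<lambda>k. Var (x (transpose i (i + 1) k))) [1..<Suc n]"
    unfolding tt_def vars_def upt using i by (simp add: transpose_def del: upt_Suc)
  have nth: "map f [1..<Suc n] ! (k - 1) = f k" if "k \<in> {1..n}" for k and f :: "nat \<Rightarrow> 'v trm"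
    by (subst nth_map_upt) (use that in auto)
  have s: "subterm_at [k] (Op ss) = Some (Var (x k))" if "k \<in> {1..n}" for k
    using that nth[OF that, of "\<lambda>k. Var (x k)"] unfolding ss by (simp del: upt_Suc)
  have t: "subterm_at [k] (Op tt) = Some (Var (x (transpose i (i + 1) k)))" if "k \<in> {1..n}" for k
    using that nth[OF that, of "\<lambda>k. Var (x (transpose i (i + 1) k))"] unfolding tt by (simp del: upt_Suc)
  have m: "maps_cone n ?g [k] [transpose i (i + 1) k]" if k: "k \<in> {1..n}" for k
  proof -
    have "transpose i (i + 1) k \<in> {1..n}" using k i by (auto simp: transpose_def)
    then have "subterm_at [transpose i (i + 1) k] (Op tt) = Some (Var (x k))" using t by simp
    then show ?thesis using s[OF k] unfolding match_rel_def maps_cone_def by blast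
  qed
  have m': "maps_cone n (act_below n p ?g) (p @ [k]) (p @ [transpose i (i + 1) k])" if k: "k \<in> {1..n}" for k
    using maps_cone_act_below[OF m[OF k]] .
  have "cone_swap n (p @ [i]) (p @ [i + 1]) = act_below n p ?g"
  proof (rule bij_rel_eqI)
    show "bij_rel (ends n) (cone_swap n (p @ [i]) (p @ [i + 1]))"
      using p i incomparable_branch[of i "i + 1" p "[]" "[]"] by (intro bij_rel_cone_swap) auto
    show "bij_rel (ends n) (act_below n p ?g)" using end_perms_bij_rel g .
    show "cone_swap n (p @ [i]) (p @ [i + 1]) \<subseteq> act_below n p ?g"
    proof (rule subrelI)
      fix y z assume "(y, z) \<in> cone_swap n (p @ [i]) (p @ [i + 1])"
      then consider w where "w \<in> ends n" "y = (p @ [i]) @- w" "z = (p @ [i + 1]) @- w"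
        | w where "w \<in> ends n" "y = (p @ [i + 1]) @- w" "z = (p @ [i]) @- w"
        | "z = y" "y \<in> ends n" "\<forall>w. y \<noteq> (p @ [i]) @- w" "\<forall>w. y \<noteq> (p @ [i + 1]) @- w"
        unfolding cone_swap_def by blast
      then show "(y, z) \<in> act_below n p ?g"
      proof cases
        case (1 w)
        then show ?thesis using m'[of i] i unfolding maps_cone_def by simp
      next
        case (2 w)
        then show ?thesis using m'[of "i + 1"] i unfolding maps_cone_def by simp
      next
        case 3
        \<comment> \<open>An end below \<open>p\<close> lies in the cone of a child, which the
          matching fixes unless it is one of the two; off the cone of \<open>p\<close>,
          \<open>act_below\<close> is the identity.\<close>
        show ?thesis
        proof (cases "\<exists>w. y = p @- w")
          case True
          then obtain k w where y: "y = p @- (k ## w)" by (metis stream.exhaust)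
          then have k: "k \<in> {1..n}" "w \<in> ends n" using 3(2) by (simp_all add: streams_Stream)
          have "k \<noteq> i" "k \<noteq> i + 1" using 3(3,4) y by auto
          then show ?thesis using m'[OF k(1)] k(2) y 3(1) unfolding maps_cone_def by simp
        qed (use 3 in \<open>auto simp: act_below_def\<close>)
      qed
    qed
  qed
  then show ?thesis using g by simp
qed

text \<open>The associativity equation with index \<open>1\<close> moves the first variable from
  \<open>[1]\<close> to \<open>[1, 1]\<close> and the second from \<open>[2, 1]\<close> to
  \<open>[1, 2]\<close>. It thus relates a pair of siblings to a pair of cones at different
  depths.\<close>

lemma assoc_move:
  assumes p: "p \<in> lists {1..n}"
  shows "\<exists>g\<in>end_perms n x. maps_cone n g (p @ [1]) (p @ [1, 1]) \<and> maps_cone n g (p @ [2, 1]) (p @ [1, 2])"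
proof -
  define ss tt where "ss = vars x 1 1 @ [Op (vars x (1 + 1) (1 + n))] @ vars x (1 + n + 1) (2 * n - 1)"
    and "tt = vars x 1 (1 - 1) @ [Op (vars x 1 (1 + n - 1))] @ vars x (1 + n) (2 * n - 1)"
  have st: "(Op ss, Op tt) \<in> SC_equations n x"
    using n2 unfolding SC_equations_def ss_def tt_def by (intro UnI1 CollectI exI[of _ 1]) simp
  let ?g = "match_rel n (Op ss) (Op tt)"
  have g: "act_below n p ?g \<in> end_perms n x" using realizes.gen[of "Op ss" "Op tt" n x p] st p by blast
  have "ss = Var (x 1) # Op (vars x 2 (1 + n)) # vars x (2 + n) (2 * n - 1)"
    unfolding ss_def by (simp add: vars_def numeral_2_eq_2)
  then have s: "subterm_at [1] (Op ss) = Some (Var (x 1))" "subterm_at [2, 1] (Op ss) = Some (Var (x 2))"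
    using n2 by (auto simp: nth_vars)
  have "tt = Op (vars x 1 n) # vars x (1 + n) (2 * n - 1)"
    unfolding tt_def by (simp add: vars_def)
  then have t: "subterm_at [1, 1] (Op tt) = Some (Var (x 1))" "subterm_at [1, 2] (Op tt) = Some (Var (x 2))"
    using n2 by (auto simp: nth_vars numeral_2_eq_2)
  have "maps_cone n ?g [1] [1, 1]" "maps_cone n ?g [2, 1] [1, 2]"
    using s t unfolding match_rel_def maps_cone_def by blast+
  then show ?thesis using g maps_cone_act_below by blast
qed

text \<open>The transposition of \<open>i\<close> and \<open>j + 1\<close> is the conjugate of that
  of \<open>i\<close> and \<open>j\<close> by that of \<open>j\<close> and
  \<open>j + 1\<close>.\<close>

lemma swap_siblings:
  assumes p: "p \<in> lists {1..n}" and ij: "i \<in> {1..n}" "j \<in> {1..n}" "i \<noteq> j"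
  shows "cone_swap n (p @ [i]) (p @ [j]) \<in> end_perms n x"
proof -
  have *: "cone_swap n (p @ [i]) (p @ [i + Suc k]) \<in> end_perms n x" if "i \<ge> 1" "i + Suc k \<le> n" for i k
    using that
  proof (induction k)
    case 0
    then show ?case using swap_adjacent[OF p, of i] by simp
  next
    case (Suc k)
    let ?j = "i + Suc k"
    have W: "p @ [i] \<in> lists {1..n}" "p @ [?j] \<in> lists {1..n}" "p @ [?j + 1] \<in> lists {1..n}" using p Suc.prems by auto
    have inc: "incomparable (p @ [i]) (p @ [?j])" "incomparable (p @ [i]) (p @ [?j + 1])"
      by (auto intro!: incomparable_branch)
    have "cone_swap n (p @ [?j]) (p @ [?j + 1]) \<in> end_perms n x" by (rule swap_adjacent) (use p Suc.prems in auto)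
    then have "cone_swap n (p @ [i]) (p @ [?j + 1]) \<in> end_perms n x"
    proof (rule end_perms_conj)
      show "cone_swap n (p @ [i]) (p @ [?j]) \<in> end_perms n x" using Suc by simp
      show "maps_cone n (cone_swap n (p @ [?j]) (p @ [?j + 1])) (p @ [i]) (p @ [i])"
        using maps_cone_swap_fixed W inc by blast
    qed (use W inc maps_cone_swap in blast)+
    then show ?case by simp
  qed
  show ?thesis
  proof (cases "i < j")
    case True
    then show ?thesis using *[of i "j - i - 1"] ij by simp
  next
    case False
    then show ?thesis using *[of j "i - j - 1"] ij cone_swap_sym by simp
  qed
qed

text \<open>The case \<open>c = d\<close> is included, with the identity, to spare
  \<open>move_siblings\<close> a case distinction.\<close>

lemma permute_siblings:
  assumes p: "p \<in> lists {1..n}" and cd: "c \<in> {1..n}" "d \<in> {1..n}"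
  shows "\<exists>h\<in>end_perms n x. \<forall>e\<in>{1..n}. maps_cone n h (p @ [e]) (p @ [transpose c d e])"
proof (cases "c = d")
  case True
  then show ?thesis using p by (intro bexI[OF _ end_perms_Id_on]) (auto simp: maps_cone_def)
next
  case False
  have "maps_cone n (cone_swap n (p @ [c]) (p @ [d])) (p @ [e]) (p @ [transpose c d e])" if "e \<in> {1..n}" for e
  proof -
    consider "e = c" | "e = d" | "e \<noteq> c" "e \<noteq> d" by blast
    then show ?thesis
    proof cases
      case 3
      have "incomparable (p @ [e]) (p @ [c])" "incomparable (p @ [e]) (p @ [d])"
        using 3 by (auto intro!: incomparable_branch)
      moreover have "p @ [e] \<in> lists {1..n}" using p that by simp
      ultimately show ?thesis using 3 maps_cone_swap_fixed by simp
    qed (simp_all add: maps_cone_swap maps_cone_swap')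
  qed
  then show ?thesis using swap_siblings[OF p cd False] by blast
qed

lemma move_siblings:
  assumes p: "p \<in> lists {1..n}" and ij: "i \<in> {1..n}" "j \<in> {1..n}" "i \<noteq> j"
  shows "\<exists>h\<in>end_perms n x. maps_cone n h (p @ [1]) (p @ [i]) \<and> maps_cone n h (p @ [2]) (p @ [j])"
proof -
  have 1: "(1::nat) \<in> {1..n}" "(2::nat) \<in> {1..n}" using n2 by auto
  \<comment> \<open>The place of child \<open>2\<close> after child \<open>1\<close> has gone to
    \<open>i\<close>. Exchanging \<open>m\<close> with \<open>j\<close> afterwards leaves
    \<open>i\<close> alone, as both differ from \<open>i\<close>.\<close>
  define m where "m = transpose 1 i (2::nat)"
  have m: "m \<in> {1..n}" "m \<noteq> i" using ij 1 by (auto simp: m_def transpose_def)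
  obtain h where h: "h \<in> end_perms n x" "\<And>e. e \<in> {1..n} \<Longrightarrow> maps_cone n h (p @ [e]) (p @ [transpose 1 i e])"
    using permute_siblings[OF p 1(1) ij(1)] by blast
  obtain k where k: "k \<in> end_perms n x" "\<And>e. e \<in> {1..n} \<Longrightarrow> maps_cone n k (p @ [e]) (p @ [transpose m j e])"
    using permute_siblings[OF p m(1) ij(2)] by blast
  have "maps_cone n h (p @ [1]) (p @ [i])" "maps_cone n h (p @ [2]) (p @ [m])"
    using h(2)[OF 1(1)] h(2)[OF 1(2)] by (simp_all add: m_def)
  moreover have "maps_cone n k (p @ [i]) (p @ [i])" "maps_cone n k (p @ [m]) (p @ [j])"
    using k(2)[OF ij(1)] k(2)[OF m(1)] m(2) ij(3) by (simp_all add: transpose_def)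
  ultimately show ?thesis using end_perms_comp[OF h(1) k(1)] maps_cone_comp by blast
qed

text \<open>Undoing the move of \<open>assoc_move\<close> conjugates the exchange of the siblings
  \<open>[1, 1]\<close> and \<open>[1, 2]\<close> into that of \<open>[1]\<close> and
  \<open>[2, 1]\<close>. Exchanges among the children of \<open>[2]\<close> then replace
  \<open>[2, 1]\<close> by \<open>[2, k]\<close>, and \<open>move_siblings\<close> carries
  \<open>1\<close> and \<open>2\<close> to \<open>i\<close> and \<open>j\<close>.\<close>

lemma swap_child_grandchild:
  assumes p: "p \<in> lists {1..n}" and ijk: "i \<in> {1..n}" "j \<in> {1..n}" "i \<noteq> j" "k \<in> {1..n}"
  shows "cone_swap n (p @ [i]) (p @ [j, k]) \<in> end_perms n x"
proof -
  have 1: "(1::nat) \<in> {1..n}" "(2::nat) \<in> {1..n}" using n2 by auto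
  have W: "p @ [1] \<in> lists {1..n}" "p @ [1, 1] \<in> lists {1..n}" "p @ [1, 2] \<in> lists {1..n}" "p @ [2] \<in> lists {1..n}" "p @ [2, 1] \<in> lists {1..n}" "p @ [2, k] \<in> lists {1..n}"
     "p @ [i] \<in> lists {1..n}" "p @ [j, k] \<in> lists {1..n}" using p 1 ijk by auto
  have inc: "incomparable (p @ [1, 1]) (p @ [1, 2])" "incomparable (p @ [1]) (p @ [2, 1])"
    "incomparable (p @ [1]) (p @ [2, k])" "incomparable (p @ [i]) (p @ [j, k])"
    using ijk(3) by (simp_all add: incomparable_def)
  obtain g where g: "g \<in> end_perms n x" "maps_cone n g (p @ [1]) (p @ [1, 1])" "maps_cone n g (p @ [2, 1]) (p @ [1, 2])"
    using assoc_move[OF p] by blast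
  have "cone_swap n (p @ [1, 1]) (p @ [1, 2]) \<in> end_perms n x"
    using swap_siblings[OF W(1), of 1 2] 1 by simp
  then have 21: "cone_swap n (p @ [1]) (p @ [2, 1]) \<in> end_perms n x"
    by (rule end_perms_conj[OF end_perms_converse[OF g(1)]]) (use maps_cone_converse g W inc in blast)+
  have "cone_swap n (p @ [1]) (p @ [2, k]) \<in> end_perms n x"
  proof (cases "k = 1")
    case False
    have "cone_swap n (p @ [2, 1]) (p @ [2, k]) \<in> end_perms n x"
      using swap_siblings[OF W(4), of 1 k] 1 ijk False by simp
    then show ?thesis
    proof (rule end_perms_conj[OF _ 21])
      show "maps_cone n (cone_swap n (p @ [2, 1]) (p @ [2, k])) (p @ [1]) (p @ [1])"
        using maps_cone_swap_fixed W inc by blast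
    qed (use W inc maps_cone_swap in blast)+
  qed (use 21 in simp)
  moreover obtain h where h: "h \<in> end_perms n x" "maps_cone n h (p @ [1]) (p @ [i])" "maps_cone n h (p @ [2]) (p @ [j])"
    using move_siblings[OF p ijk(1-3)] by blast
  have "maps_cone n h (p @ [2, k]) (p @ [j, k])" using maps_cone_append[OF h(3), of "[k]"] ijk by simp
  ultimately show ?thesis using end_perms_conj[of h "p @ [1]" "p @ [2, k]" "p @ [i]" "p @ [j, k]"] h W inc by blast
qed

text \<open>For \<open>w = w'' @ [m, k]\<close> choose a letter \<open>m'\<close> different from
  \<open>m\<close> and let \<open>r = p @ j # w''\<close>. The exchange of \<open>r @ [m']\<close>
  with \<open>r @ [m, k]\<close> is known. By induction so is the exchange of \<open>p @ [i]\<close>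
  with \<open>r @ [m']\<close>, which fixes the cone of \<open>r @ [m, k]\<close>; conjugating by it
  puts \<open>p @ [i]\<close> in the place of \<open>r @ [m']\<close>.\<close>

lemma swap_child_descendant:
  assumes p: "p \<in> lists {1..n}" and ij: "i \<in> {1..n}" "j \<in> {1..n}" "i \<noteq> j" and w: "w \<in> lists {1..n}"
  shows "cone_swap n (p @ [i]) (p @ j # w) \<in> end_perms n x"
  using w
proof (induction w rule: length_induct)
  case (1 w)
  show ?case
  proof (cases w rule: rev_cases)
    case Nil
    then show ?thesis using swap_siblings[OF p ij] by simp
  next
    case (snoc w' k)
    have k: "k \<in> {1..n}" "w' \<in> lists {1..n}" using 1(2) snoc by auto
    show ?thesis
    proof (cases w' rule: rev_cases)
      case Nil
      then show ?thesis using swap_child_grandchild[OF p ij k(1)] snoc by simp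
    next
      case (snoc w'' m)
      have m: "m \<in> {1..n}" "w'' \<in> lists {1..n}" using k snoc by auto
      have "\<exists>m'\<in>{1..n}. m' \<noteq> m" using n2 by (metis atLeastAtMost_iff le_refl one_le_numeral order_trans numeral_eq_one_iff semiring_norm(85))
      then obtain m' where m': "m' \<in> {1..n}" "m' \<noteq> m" by blast
      let ?r = "p @ j # w''"
      have r: "?r \<in> lists {1..n}" using p ij m by auto
      have w: "w = w'' @ [m, k]" using \<open>w = w' @ [k]\<close> snoc by simp
      have W: "p @ [i] \<in> lists {1..n}" "?r @ [m'] \<in> lists {1..n}" "?r @ [m, k] \<in> lists {1..n}" using r m m' k p ij by auto
      have inc: "incomparable (?r @ [m']) (?r @ [m, k])" "incomparable (p @ [i]) (?r @ [m'])"
        "incomparable (p @ [i]) (?r @ [m, k])" "incomparable (?r @ [m, k]) (?r @ [m'])" "incomparable (?r @ [m, k]) (p @ [i])"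
        using m'(2) ij(3) by (auto simp: incomparable_def)
      have "length (w'' @ [m']) < length w" "w'' @ [m'] \<in> lists {1..n}" using w m m' by auto
      then have "cone_swap n (p @ [i]) (p @ j # w'' @ [m']) \<in> end_perms n x" using 1(1) by blast
      then have f: "cone_swap n (p @ [i]) (?r @ [m']) \<in> end_perms n x" by simp
      have "cone_swap n (?r @ [m']) (?r @ [m, k]) \<in> end_perms n x"
        by (rule swap_child_grandchild[OF r m'(1) m(1) m'(2) k(1)])
      then have "cone_swap n (p @ [i]) (?r @ [m, k]) \<in> end_perms n x"
      proof (rule end_perms_conj[OF f])
        show "maps_cone n (cone_swap n (p @ [i]) (?r @ [m'])) (?r @ [m']) (p @ [i])" by (rule maps_cone_swap')
        show "maps_cone n (cone_swap n (p @ [i]) (?r @ [m'])) (?r @ [m, k]) (?r @ [m, k])"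
          using maps_cone_swap_fixed W inc by blast
      qed (use W inc in blast)+
      then show ?thesis using w by simp
    qed
  qed
qed

lemma cone_swap_in_end_perms:
  assumes uv: "u \<in> lists {1..n}" "v \<in> lists {1..n}" "incomparable u v"
  shows "cone_swap n u v \<in> end_perms n x"
proof -
  obtain p i j u' v' where d: "i \<noteq> j" "u = p @ i # u'" "v = p @ j # v'" using incomparableD uv(3) by blast
  then have w: "p \<in> lists {1..n}" "i \<in> {1..n}" "j \<in> {1..n}" "u' \<in> lists {1..n}" "v' \<in> lists {1..n}" using uv by auto
  \<comment> \<open>This exchange carries \<open>p @ [i]\<close> to \<open>v\<close>, and hence
    \<open>p @ j # v' @ u'\<close>, which is \<open>v @ u'\<close>, to \<open>p @ i # u'\<close>,
    which is \<open>u\<close>. So it conjugates an exchange of a child with a descendant into the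
    required one.\<close>
  let ?f = "cone_swap n (p @ [i]) (p @ j # v')"
  have f: "?f \<in> end_perms n x" using swap_child_descendant w d by blast
  have W: "p @ [i] \<in> lists {1..n}" "p @ j # v' @ u' \<in> lists {1..n}" using w by auto
  have inc: "incomparable (p @ [i]) (p @ j # v' @ u')" "incomparable (p @ j # v') (p @ i # u')"
    using d by (auto simp: incomparable_def)
  have "cone_swap n (p @ [i]) (p @ j # v' @ u') \<in> end_perms n x" using swap_child_descendant w d by simp
  moreover have "maps_cone n ?f (p @ [i]) (p @ j # v')" by (rule maps_cone_swap)
  moreover have "maps_cone n ?f (p @ j # v' @ u') (p @ i # u')"
    using maps_cone_append[OF maps_cone_swap' w(4), of "p @ [i]" "p @ j # v'"] by simp
  ultimately have "cone_swap n (p @ j # v') (p @ i # u') \<in> end_perms n x"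
    using end_perms_conj[OF f] W inc uv d by blast
  then show ?thesis using d cone_swap_sym by simp
qed

section \<open>From exchanges to all bijections of codes\<close>

lemma code_rel_permutes:
  assumes C: "complete_code n C" and \<pi>: "\<pi> permutes C"
  shows "code_rel n C \<pi> \<in> end_perms n x"
  using complete_codeD(1)[OF C] \<pi>
proof (induction rule: permutes_rev_induct)
  case id
  then show ?case using code_rel_id[OF C] end_perms_Id_on by (simp add: id_def)
next
  case (swap a b \<pi>)
  show ?case
  proof (cases "a = b")
    case False
    have "bij_betw (transpose a b) C C" using swap by (simp add: bij_betw_def)
    then have eq: "code_rel n C (\<pi> \<circ> transpose a b) = code_rel n C (transpose a b) O code_rel n C \<pi>"
      using code_rel_comp[OF C C C] swap permutes_imp_bij by metis
    have "code_rel n C (transpose a b) \<in> end_perms n x"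
      using code_rel_transpose[OF C] cone_swap_in_end_perms complete_codeD(2)[OF C] code_incomparable[OF C] swap False by metis
    then show ?thesis unfolding eq by (rule end_perms_comp) (rule swap)
  qed (use swap in simp)
qed

text \<open>Up to a permutation of \<open>D\<close>, which \<open>code_rel_permutes\<close> handles,
  it is enough to realize one bijection from \<open>C\<close> to \<open>D\<close>. Contract siblings
  to \<open>l\<close> in \<open>C\<close> and to \<open>m\<close> in \<open>D\<close>: a bijection
  of the smaller codes with \<open>l\<close> going to \<open>m\<close> is covered by induction, and
  expanding it at \<open>l\<close> does not change its action.\<close>

lemma code_rel_in_end_perms:
  assumes "complete_code n C" "complete_code n D" "bij_betw \<sigma> C D"
  shows "code_rel n C \<sigma> \<in> end_perms n x"
  using assms
proof (induction "card C" arbitrary: C D \<sigma> rule: less_induct)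
  case less
  have n0: "n > 0" using n2 by simp
  have card: "card C = card D" using less.prems bij_betw_same_card by blast
  show ?case
  proof (cases "C = {[]} \<or> D = {[]}")
    case True
    \<comment> \<open>Any other code arises by expansion from a nonempty code, so it has at least
      \<open>n\<close> words, and \<open>n \<ge> 2\<close>.\<close>
    have one: "E = {[]}" if E: "complete_code n E" "card E = 1" for E
    proof (rule ccontr)
      assume "E \<noteq> {[]}"
      then obtain F l where "complete_code n F" "l \<in> F" "E = F - {l} \<union> children n l"
        using complete_code_contract[OF E(1) _ n0] by blast
      moreover from this have "card F > 0" using complete_codeD(1) card_gt_0_iff by blast
      ultimately show False using card_expand[of n F l] E(2) n2 by simp
    qed
    have "card C = 1" "card D = 1" using True card by auto
    then have "C = {[]}" "D = {[]}" using one less.prems by blast+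
    then have "\<And>l. l \<in> C \<Longrightarrow> \<sigma> l = l" using less.prems(3) by (simp add: bij_betw_def)
    then have "code_rel n C \<sigma> = code_rel n C (\<lambda>l. l)" by (rule code_rel_cong)
    then show ?thesis using code_rel_id[OF less.prems(1)] end_perms_Id_on by simp
  next
    case False
    obtain C' l where C': "complete_code n C'" "l \<in> C'" "C = C' - {l} \<union> children n l"
      using complete_code_contract[OF less.prems(1) _ n0] False by blast
    obtain D' m where D': "complete_code n D'" "m \<in> D'" "D = D' - {m} \<union> children n m"
      using complete_code_contract[OF less.prems(2) _ n0] False by blast
    have c: "card C' = card D'" "card C' < card C"
      using card_expand[OF C'(1,2)] card_expand[OF D'(1,2)] C'(3) D'(3) card n2 by simp_all
    have fin: "finite C'" "finite D'" using C' D' complete_codeD(1) by blast+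
    then obtain \<tau>0 where \<tau>0: "bij_betw \<tau>0 C' D'" using c finite_same_card_bij by blast
    \<comment> \<open>A transposition in the target corrects an arbitrary bijection so that it sends
      \<open>l\<close> to \<open>m\<close>.\<close>
    define \<tau> where "\<tau> = transpose (\<tau>0 l) m \<circ> \<tau>0"
    have "\<tau>0 l \<in> D'" using \<tau>0 C'(2) by (auto simp: bij_betw_def)
    then have "bij_betw (transpose (\<tau>0 l) m) D' D'" using D' by (simp add: bij_betw_def)
    then have \<tau>: "bij_betw \<tau> C' D'" "\<tau> l = m" unfolding \<tau>_def using bij_betw_trans[OF \<tau>0] by auto
    \<comment> \<open>On the children of \<open>l\<close>, \<open>last k\<close> recovers the letter
      of the child.\<close>
    define \<tau>' where "\<tau>' k = (if k \<in> C' - {l} then \<tau> k else m @ [last k])" for k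
    have ch: "\<tau>' (l @ [i]) = m @ [i]" if "i \<in> {1..n}" for i
      using children_disjoint[OF C'(1,2)] that unfolding \<tau>'_def by auto
    have "bij_betw \<tau> (C' - {l}) (D' - {m})" using \<tau> C'(2) D'(2) bij_betw_DiffI[OF \<tau>(1), of "{l}" "{m}"] by auto
    then have 1: "bij_betw \<tau>' (C' - {l}) (D' - {m})" by (rule bij_betw_cong[THEN iffD1, rotated]) (simp add: \<tau>'_def)
    have 2: "bij_betw \<tau>' (children n l) (children n m)"
      unfolding bij_betw_def inj_on_def image_image using ch by auto
    have \<tau>'b: "bij_betw \<tau>' C D" unfolding C'(3) D'(3)
      by (rule bij_betw_combine[OF 1 2]) (use children_disjoint[OF D'(1,2)] in blast)
    have "code_rel n C' \<tau> \<in> end_perms n x" using less.hyps[OF c(2) C'(1) D'(1) \<tau>(1)] .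
    moreover have "code_rel n C \<tau>' \<subseteq> code_rel n C' \<tau>"
    proof (rule code_rel_subsetI)
      fix k assume k: "k \<in> C"
      show "maps_cone n (code_rel n C' \<tau>) k (\<tau>' k)"
      proof (cases "k \<in> C' - {l}")
        case True
        then show ?thesis using maps_cone_code_rel[of k C' n \<tau>] by (simp add: \<tau>'_def)
      next
        case False
        then obtain i where i: "i \<in> {1..n}" "k = l @ [i]" using k C'(3) by blast
        then show ?thesis using maps_cone_append[OF maps_cone_code_rel[OF C'(2)], of "[i]" n \<tau>] ch \<tau>(2) by simp
      qed
    qed
    ultimately have \<tau>'_perm: "code_rel n C \<tau>' \<in> end_perms n x"
      using bij_rel_eqI[OF bij_rel_code_rel[OF less.prems(1,2) \<tau>'b] bij_rel_code_rel[OF C'(1) D'(1) \<tau>(1)]] by simp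
    \<comment> \<open>The correction from \<open>\<tau>'\<close> to \<open>\<sigma>\<close>,
      continued by the identity off \<open>D\<close> as \<open>permutes\<close> demands.\<close>
    define \<pi> where "\<pi> k = (if k \<in> D then \<sigma> (inv_into C \<tau>' k) else k)" for k
    have "bij_betw (\<sigma> \<circ> inv_into C \<tau>') D D"
      using bij_betw_trans[OF bij_betw_inv_into[OF \<tau>'b] less.prems(3)] .
    then have \<pi>b: "bij_betw \<pi> D D" by (rule bij_betw_cong[THEN iffD1, rotated]) (simp add: \<pi>_def)
    then have "\<pi> permutes D" by (rule bij_imp_permutes) (simp add: \<pi>_def)
    then have "code_rel n D \<pi> \<in> end_perms n x" using code_rel_permutes less.prems(2) by blast
    then have "code_rel n C (\<pi> \<circ> \<tau>') \<in> end_perms n x"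
      unfolding code_rel_comp[OF less.prems(1,2,2) \<tau>'b \<pi>b, symmetric] by (rule end_perms_comp[OF \<tau>'_perm])
    moreover have "code_rel n C (\<pi> \<circ> \<tau>') = code_rel n C \<sigma>"
    proof (rule code_rel_cong)
      fix k assume "k \<in> C"
      then show "(\<pi> \<circ> \<tau>') k = \<sigma> k" using \<tau>'b by (auto simp: \<pi>_def bij_betw_def)
    qed
    ultimately show ?thesis by simp
  qed
qed

end

subsection \<open>Tree diagrams as permutations of the ends\<close>

definition diagram_rel :: "nat \<Rightarrow> diagram \<Rightarrow> (nat stream \<times> nat stream) set" where
  "diagram_rel n d = (case d of (T1, T2, \<sigma>) \<Rightarrow> code_rel n (leaves T1) \<sigma>)"

lemma tree_diagramD:
  assumes "(T1, T2, \<sigma>) \<in> tree_diagrams n"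
  shows "T1 \<in> nary_trees n" "T2 \<in> nary_trees n" "complete_code n (leaves T1)" "complete_code n (leaves T2)"
    "\<sigma> \<in> extensional (leaves T1)" "bij_betw \<sigma> (leaves T1) (leaves T2)"
  using assms complete_code_leaves unfolding tree_diagrams_def by auto

lemma tree_diagramI:
  assumes "T1 \<in> nary_trees n" "T2 \<in> nary_trees n" "\<sigma> \<in> extensional (leaves T1)" "bij_betw \<sigma> (leaves T1) (leaves T2)"
  shows "(T1, T2, \<sigma>) \<in> tree_diagrams n"
  using assms bij_betw_same_card[OF assms(4)] unfolding tree_diagrams_def by simp

lemma bij_rel_diagram_rel:
  assumes "d \<in> tree_diagrams n"
  shows "bij_rel (ends n) (diagram_rel n d)"
proof -
  obtain T1 T2 \<sigma> where d: "d = (T1, T2, \<sigma>)" by (cases d)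
  show ?thesis
    using bij_rel_code_rel[OF tree_diagramD(3,4,6)] assms unfolding d diagram_rel_def by simp
qed

lemma simple_expansion_diagrams: "(d, e) \<in> simple_expansion n \<Longrightarrow> d \<in> tree_diagrams n \<and> e \<in> tree_diagrams n"
  unfolding simple_expansion_def by auto

lemma expansions_diagrams: "(d, e) \<in> (simple_expansion n)\<^sup>* \<Longrightarrow> d \<in> tree_diagrams n \<Longrightarrow> e \<in> tree_diagrams n"
  by (induction rule: rtrancl_induct) (auto dest: simple_expansion_diagrams)

text \<open>Replacing the prefix \<open>l\<close> amounts to replacing each \<open>l @ [i]\<close>,
  so the action does not notice an expansion.\<close>

lemma diagram_rel_simple_expansion:
  assumes "(d, e) \<in> simple_expansion n"
  shows "diagram_rel n e = diagram_rel n d"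
proof -
  obtain T1 T2 \<sigma> T1' T2' \<sigma>' l where d: "d = (T1, T2, \<sigma>)" "e = (T1', T2', \<sigma>')"
    and l: "l \<in> leaves T1" "T1' = expand_at n l T1"
      "\<forall>v \<in> leaves T1 - {l}. \<sigma>' v = \<sigma> v" "\<forall>i \<in> {1..n}. \<sigma>' (l @ [i]) = \<sigma> l @ [i]"
    using assms unfolding simple_expansion_def by blast
  have D: "d \<in> tree_diagrams n" "e \<in> tree_diagrams n" using simple_expansion_diagrams[OF assms] by blast+
  have lv: "leaves T1' = leaves T1 - {l} \<union> children n l"
    using expand_at_leaves[OF tree_diagramD(1)] D(1) d l by blast
  have "diagram_rel n e \<subseteq> diagram_rel n d"
    unfolding d diagram_rel_def prod.case
  proof (rule code_rel_subsetI)
    fix k assume k: "k \<in> leaves T1'"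
    show "maps_cone n (code_rel n (leaves T1) \<sigma>) k (\<sigma>' k)"
    proof (cases "k \<in> leaves T1 - {l}")
      case True
      then show ?thesis using maps_cone_code_rel[of k "leaves T1" n \<sigma>] l(3) by simp
    next
      case False
      then obtain i where i: "i \<in> {1..n}" "k = l @ [i]" using k lv by blast
      then show ?thesis using maps_cone_append[OF maps_cone_code_rel[OF l(1)], of "[i]" n \<sigma>] l(4) by simp
    qed
  qed
  then show ?thesis using bij_rel_eqI bij_rel_diagram_rel D by blast
qed

lemma diagram_rel_expansions: "(d, e) \<in> (simple_expansion n)\<^sup>* \<Longrightarrow> diagram_rel n e = diagram_rel n d"
  by (induction rule: rtrancl_induct) (auto dest: diagram_rel_simple_expansion)

lemma simple_expansion_exists:
  assumes d: "(T1, T2, \<sigma>) \<in> tree_diagrams n" and l: "l \<in> leaves T1"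
  shows "\<exists>T2' \<sigma>'. ((T1, T2, \<sigma>), (expand_at n l T1, T2', \<sigma>')) \<in> simple_expansion n"
proof -
  note D = tree_diagramD[OF d]
  have m: "\<sigma> l \<in> leaves T2" using D(6) l by (auto simp: bij_betw_def)
  note e1 = expand_at_leaves[OF D(1) l] and e2 = expand_at_leaves[OF D(2) m]
  let ?T1 = "expand_at n l T1" and ?T2 = "expand_at n (\<sigma> l) T2"
  define \<sigma>' where "\<sigma>' = (\<lambda>k\<in>leaves ?T1. if k \<in> leaves T1 - {l} then \<sigma> k else \<sigma> l @ [last k])"
  have old: "\<sigma>' k = \<sigma> k" if "k \<in> leaves T1 - {l}" for k
    using that e1 by (simp add: \<sigma>'_def)
  have new: "\<sigma>' (l @ [i]) = \<sigma> l @ [i]" if i: "i \<in> {1..n}" for i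
  proof -
    have "l @ [i] \<in> children n l" using i by blast
    then have "l @ [i] \<in> leaves ?T1" "l @ [i] \<notin> leaves T1" using children_disjoint[OF D(3) l] e1 by blast+
    then show ?thesis by (simp add: \<sigma>'_def)
  qed
  have "bij_betw \<sigma> (leaves T1 - {l}) (leaves T2 - {\<sigma> l})"
    using bij_betw_DiffI[OF D(6), of "{l}" "{\<sigma> l}"] l m by auto
  then have 1: "bij_betw \<sigma>' (leaves T1 - {l}) (leaves T2 - {\<sigma> l})"
    by (rule bij_betw_cong[THEN iffD1, rotated]) (simp add: old)
  have 2: "bij_betw \<sigma>' (children n l) (children n (\<sigma> l))"
    unfolding bij_betw_def inj_on_def image_image using new by auto
  have "bij_betw \<sigma>' (leaves ?T1) (leaves ?T2)"
    unfolding e1[THEN conjunct2] e2[THEN conjunct2]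
    by (rule bij_betw_combine[OF 1 2]) (use children_disjoint[OF D(4) m] in blast)
  then have "(?T1, ?T2, \<sigma>') \<in> tree_diagrams n"
    using e1 e2 by (intro tree_diagramI) (simp_all add: \<sigma>'_def)
  then show ?thesis using d l old new unfolding simple_expansion_def by blast
qed

section \<open>Equivalent diagrams and equal actions\<close>

abbreviation words :: "nat \<Rightarrow> nat \<Rightarrow> nat list set" where
  "words n N \<equiv> {p \<in> lists {1..n}. length p = N}"

lemma complete_code_words: "complete_code n (words n N)"
  unfolding complete_code_def
proof (intro conjI ballI allI impI)
  show "finite (words n N)" using finite_lists_length_eq[of "{1..n}" N] by (simp add: lists_eq_set)
  show "\<exists>l\<in>words n N. \<exists>w. z = l @- w" if "z \<in> ends n" for z
    using ends_split[OF that, of N] by blast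
  show "l = l'" if "l \<in> words n N" "l' \<in> words n N" "l @- w = l' @- w'" for l l' w w'
    using shift_same_length[OF that(3)] that(1,2) by simp
qed blast

text \<open>An end in the cone of a word of \<open>D\<close> is covered by a word of
  \<open>C\<close>, which also belongs to \<open>D\<close>; prefix-freeness makes the two
  equal.\<close>

lemma complete_code_eqI:
  assumes n: "n > 0" and C: "complete_code n C" and D: "complete_code n D" and "C \<subseteq> D"
  shows "C = D"
proof
  show "D \<subseteq> C"
  proof
    fix p assume p: "p \<in> D"
    then have "p @- sconst 1 \<in> ends n" using n complete_codeD(2)[OF D p] sconst_in_ends[of 1 n] by simp
    then obtain l w where "l \<in> C" "p @- sconst 1 = l @- w" using complete_code_cover[OF C] by blast
    then show "p \<in> C" using complete_codeD(3)[OF D p] \<open>C \<subseteq> D\<close> by blast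
  qed
qed (fact assms(4))

text \<open>The measure counts the words shorter than \<open>N\<close> at or below a leaf, the
  places where an expansion may still happen. Expanding at \<open>l\<close> removes \<open>l\<close>
  from this set and adds nothing. When all leaves have length \<open>N\<close>,
  \<open>complete_code_eqI\<close> identifies them with all words of that length.\<close>

lemma expand_to_words:
  assumes n: "n > 0" and "(T1, T2, \<sigma>) \<in> tree_diagrams n" "\<And>l. l \<in> leaves T1 \<Longrightarrow> length l \<le> N"
  shows "\<exists>S S2 \<tau>. ((T1, T2, \<sigma>), (S, S2, \<tau>)) \<in> (simple_expansion n)\<^sup>* \<and> leaves S = words n N"
  using assms(2-)
proof (induction "card {a \<in> lists {1..n}. length a < N \<and> (\<exists>l\<in>leaves T1. \<exists>r. a = l @ r)}"
    arbitrary: T1 T2 \<sigma> rule: less_induct)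
  case less
  note D = tree_diagramD[OF less.prems(1)]
  show ?case
  proof (cases "\<forall>l\<in>leaves T1. length l = N")
    case True
    then have "leaves T1 \<subseteq> words n N" using complete_codeD(2)[OF D(3)] by blast
    then have "leaves T1 = words n N" by (rule complete_code_eqI[OF n D(3) complete_code_words])
    then show ?thesis by blast
  next
    case False
    then obtain l where l: "l \<in> leaves T1" "length l < N" using less.prems(2) by fastforce
    obtain T2' \<sigma>' where e: "((T1, T2, \<sigma>), (expand_at n l T1, T2', \<sigma>')) \<in> simple_expansion n"
      using simple_expansion_exists[OF less.prems(1) l(1)] by blast
    have lv: "leaves (expand_at n l T1) = leaves T1 - {l} \<union> children n l"
      using expand_at_leaves[OF D(1) l(1)] by blast
    let ?A = "\<lambda>T. {a \<in> lists {1..n}. length a < N \<and> (\<exists>l\<in>leaves T. \<exists>r. a = l @ r)}"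
    have "?A T1 \<subseteq> {a. set a \<subseteq> {1..n} \<and> length a \<le> N}" by auto
    then have fin: "finite (?A T1)" by (rule finite_subset) (rule finite_lists_length_le, simp)
    have "l \<in> ?A T1" using l complete_codeD(2)[OF D(3) l(1)] by auto
    moreover have "l \<notin> ?A (expand_at n l T1)"
    proof
      assume "l \<in> ?A (expand_at n l T1)"
      then obtain k r where "k \<in> leaves T1 - {l} \<union> children n l" "l = k @ r" unfolding lv by blast
      then show False using complete_code_prefix[OF D(3), of k r] l(1) by auto
    qed
    moreover have "?A (expand_at n l T1) \<subseteq> ?A T1"
    proof
      fix a assume a: "a \<in> ?A (expand_at n l T1)"
      then obtain k r where k: "k \<in> leaves T1 - {l} \<union> children n l" "a = k @ r" unfolding lv by blast
      have "\<exists>l\<in>leaves T1. \<exists>r. a = l @ r"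
      proof (cases "k \<in> leaves T1")
        case False
        then obtain i where "k = l @ [i]" using k(1) by blast
        then have "a = l @ (i # r)" using k(2) by simp
        then show ?thesis using l(1) by blast
      qed (use k(2) in blast)
      then show "a \<in> ?A T1" using a by blast
    qed
    ultimately have lt: "card (?A (expand_at n l T1)) < card (?A T1)"
      using fin by (intro psubset_card_mono psubsetI) blast+
    have d: "(expand_at n l T1, T2', \<sigma>') \<in> tree_diagrams n" using simple_expansion_diagrams e by blast
    have "length k \<le> N" if "k \<in> leaves (expand_at n l T1)" for k
      using that l less.prems(2) unfolding lv by auto
    then obtain S S2 \<tau> where "((expand_at n l T1, T2', \<sigma>'), (S, S2, \<tau>)) \<in> (simple_expansion n)\<^sup>*" "leaves S = words n N"
      using less.hyps[OF lt d] by blast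
    then show ?thesis using e by (meson converse_rtrancl_into_rtrancl)
  qed
qed

lemma code_rel_eqD:
  assumes "n \<ge> 2" "bij_rel (ends n) (code_rel n C \<sigma>)" "code_rel n C \<sigma> = code_rel n C \<tau>" "l \<in> C"
  shows "\<sigma> l = \<tau> l"
  using maps_cone_unique[OF assms(1,2) maps_cone_code_rel[OF assms(4)]] maps_cone_code_rel[OF assms(4), of n \<tau>] assms(3)
  by simp

text \<open>Once the source trees agree, equal actions give the bijections the same value at each
  leaf because a cone determines its word. Extensionality then makes the bijections equal, and the
  target trees agree since their leaves are the images.\<close>

lemma diagram_equiv_iff:
  assumes n: "n \<ge> 2"
  shows "diagram_equiv n = {(d, e). d \<in> tree_diagrams n \<and> e \<in> tree_diagrams n \<and> diagram_rel n d = diagram_rel n e}"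
proof (intro equalityI subrelI)
  fix d e assume "(d, e) \<in> diagram_equiv n"
  then obtain f where de: "d \<in> tree_diagrams n" "e \<in> tree_diagrams n"
    and f: "(d, f) \<in> (simple_expansion n)\<^sup>*" "(e, f) \<in> (simple_expansion n)\<^sup>*"
    unfolding diagram_equiv_def by blast
  have "diagram_rel n d = diagram_rel n e"
    using diagram_rel_expansions[OF f(1)] diagram_rel_expansions[OF f(2)] by (rule subst)
  then show "(d, e) \<in> {(d, e). d \<in> tree_diagrams n \<and> e \<in> tree_diagrams n \<and> diagram_rel n d = diagram_rel n e}"
    using de by simp
next
  fix d e assume "(d, e) \<in> {(d, e). d \<in> tree_diagrams n \<and> e \<in> tree_diagrams n \<and> diagram_rel n d = diagram_rel n e}"
  then have de: "d \<in> tree_diagrams n" "e \<in> tree_diagrams n" "diagram_rel n d = diagram_rel n e" by auto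
  obtain T1 T2 \<sigma> where d: "d = (T1, T2, \<sigma>)" by (cases d)
  obtain U1 U2 \<tau> where e: "e = (U1, U2, \<tau>)" by (cases e)
  define N where "N = Max (length ` (leaves T1 \<union> leaves U1))"
  have "finite (leaves T1 \<union> leaves U1)"
    using complete_codeD(1) tree_diagramD(3) de(1,2) d e by blast
  then have N: "length l \<le> N" if "l \<in> leaves T1 \<union> leaves U1" for l using that unfolding N_def by simp
  obtain S S2 \<sigma>' where S: "(d, (S, S2, \<sigma>')) \<in> (simple_expansion n)\<^sup>*" "leaves S = words n N"
    using expand_to_words[of n T1 T2 \<sigma> N] de(1) N n d by auto
  obtain R R2 \<tau>' where R: "(e, (R, R2, \<tau>')) \<in> (simple_expansion n)\<^sup>*" "leaves R = words n N"
    using expand_to_words[of n U1 U2 \<tau> N] de(2) N n e by auto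
  have SD: "(S, S2, \<sigma>') \<in> tree_diagrams n" using expansions_diagrams[OF S(1) de(1)] .
  have RD: "(R, R2, \<tau>') \<in> tree_diagrams n" using expansions_diagrams[OF R(1) de(2)] .
  note S' = tree_diagramD[OF SD] and R' = tree_diagramD[OF RD]
  have SR: "S = R" using leaves_inj[OF S'(1) R'(1)] S(2) R(2) by simp
  have "diagram_rel n (S, S2, \<sigma>') = diagram_rel n (R, R2, \<tau>')"
    using diagram_rel_expansions[OF S(1)] diagram_rel_expansions[OF R(1)] de(3) by simp
  then have "code_rel n (leaves S) \<sigma>' = code_rel n (leaves S) \<tau>'" by (simp add: diagram_rel_def SR)
  then have "\<sigma>' l = \<tau>' l" if "l \<in> leaves S" for l
    using code_rel_eqD[OF n bij_rel_code_rel[OF S'(3,4,6)] _ that] by blast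
  then have \<sigma>\<tau>: "\<sigma>' = \<tau>'" using extensionalityI[OF S'(5), of \<tau>'] R'(5) SR by blast
  have "leaves S2 = leaves R2" using S'(6) R'(6) \<sigma>\<tau> SR by (simp add: bij_betw_def)
  then have "S2 = R2" using leaves_inj S'(2) R'(2) by blast
  then show "(d, e) \<in> diagram_equiv n"
    using S(1) R(1) SR \<sigma>\<tau> de(1,2) unfolding diagram_equiv_def by blast
qed

section \<open>Diagrams with a prescribed action\<close>

text \<open>The cones of the images cover because \<open>g\<close> is onto. Prefix-freeness concerns
  all streams, whereas \<open>g\<close> knows only ends; it is therefore reduced to the case that
  \<open>\<sigma> l'\<close> extends \<open>\<sigma> l\<close>, where the end
  \<open>\<sigma> l' @- sconst 1\<close> has preimages in the cones of both \<open>l\<close> and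
  \<open>l'\<close>.\<close>

lemma complete_code_image:
  assumes n: "n > 0" and C: "complete_code n C" and g: "bij_rel (ends n) g"
    and \<sigma>: "\<And>l. l \<in> C \<Longrightarrow> \<sigma> l \<in> lists {1..n} \<and> maps_cone n g l (\<sigma> l)"
  shows "complete_code n (\<sigma> ` C)" "inj_on \<sigma> C"
proof -
  have prefix: "l = l'" if l: "l \<in> C" "l' \<in> C" "\<sigma> l' = \<sigma> l @ r" for l l' r
  proof -
    let ?w = "sconst 1"
    have w: "?w \<in> ends n" "r @- ?w \<in> ends n" using \<sigma>[OF l(2)] l(3) n sconst_in_ends[of 1 n] by auto
    have "(l @- (r @- ?w), \<sigma> l @- (r @- ?w)) \<in> g" "(l' @- ?w, \<sigma> l' @- ?w) \<in> g"
      using \<sigma> l w unfolding maps_cone_def by blast+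
    then have "l @- (r @- ?w) = l' @- ?w" using bij_rel_inj[OF g] l(3) by simp
    then show ?thesis using complete_codeD(3)[OF C l(1,2)] by blast
  qed
  show "inj_on \<sigma> C" by (rule inj_onI) (use prefix[of _ _ "[]"] in auto)
  show "complete_code n (\<sigma> ` C)"
    unfolding complete_code_def
  proof (intro conjI ballI allI impI)
    show "finite (\<sigma> ` C)" using complete_codeD(1)[OF C] by simp
    show "\<sigma> ` C \<subseteq> lists {1..n}" using \<sigma> by blast
  next
    fix z assume "z \<in> ends n"
    then obtain y where y: "(y, z) \<in> g" using bij_rel_surj[OF g] by blast
    then have "y \<in> ends n" using bij_rel_subset[OF g] by blast
    then obtain l w where l: "l \<in> C" "w \<in> ends n" "y = l @- w" using complete_code_cover[OF C] by blast
    then have "(y, \<sigma> l @- w) \<in> g" using \<sigma> unfolding maps_cone_def by blast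
    then have "z = \<sigma> l @- w" using bij_rel_functional[OF g y] by blast
    then show "\<exists>k\<in>\<sigma> ` C. \<exists>w. z = k @- w" using l by blast
  next
    fix a b w w' assume "a \<in> \<sigma> ` C" "b \<in> \<sigma> ` C" and eq: "a @- w = b @- w'"
    then obtain l l' where l: "l \<in> C" "a = \<sigma> l" "l' \<in> C" "b = \<sigma> l'" by blast
    show "a = b"
    proof (cases "length a \<le> length b")
      case True
      then obtain r where "b = a @ r" using shift_prefix[OF eq] by blast
      then have "\<sigma> l' = \<sigma> l @ r" using l by simp
      then have "l = l'" by (rule prefix[OF l(1,3)])
      then show ?thesis using l by simp
    next
      case False
      then obtain r where "a = b @ r" using shift_prefix[OF eq[symmetric]] by auto
      then have "\<sigma> l = \<sigma> l' @ r" using l by simp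
      then have "l' = l" by (rule prefix[OF l(3,1)])
      then show ?thesis using l by simp
    qed
  qed
qed

lemma diagram_of_bij_rel:
  assumes n: "n \<ge> 2" and g: "bij_rel (ends n) g"
    and N: "\<forall>p\<in>words n N. \<exists>q\<in>lists {1..n}. maps_cone n g p q"
  shows "\<exists>S S2 \<tau>. (S, S2, \<tau>) \<in> tree_diagrams n \<and> leaves S = words n N \<and> diagram_rel n (S, S2, \<tau>) = g"
proof -
  obtain \<sigma> where \<sigma>: "\<And>p. p \<in> words n N \<Longrightarrow> \<sigma> p \<in> lists {1..n} \<and> maps_cone n g p (\<sigma> p)"
    using N by metis
  define \<tau> where "\<tau> = restrict \<sigma> (words n N)"
  have \<tau>: "\<tau> p \<in> lists {1..n} \<and> maps_cone n g p (\<tau> p)" if "p \<in> words n N" for p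
    using \<sigma>[OF that] that by (simp add: \<tau>_def)
  have n0: "n > 0" using n by simp
  note im = complete_code_image[OF n0 complete_code_words g \<tau>]
  obtain S where S: "S \<in> nary_trees n" "leaves S = words n N"
    using tree_of_complete_code[OF complete_code_words n] by blast
  obtain S2 where S2: "S2 \<in> nary_trees n" "leaves S2 = \<tau> ` words n N"
    using tree_of_complete_code[OF im(1) n] by blast
  have "bij_betw \<tau> (leaves S) (leaves S2)" using im(2) S S2 by (simp add: bij_betw_def)
  moreover have "\<tau> \<in> extensional (leaves S)" using S by (simp add: \<tau>_def)
  ultimately have D: "(S, S2, \<tau>) \<in> tree_diagrams n" using S S2 by (intro tree_diagramI)
  have "diagram_rel n (S, S2, \<tau>) \<subseteq> g"
    unfolding diagram_rel_def prod.case S(2) by (rule code_rel_subsetI) (use \<tau> in blast)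
  then have "diagram_rel n (S, S2, \<tau>) = g" by (rule bij_rel_eqI[OF bij_rel_diagram_rel[OF D] g])
  then show ?thesis using D S by blast
qed

lemma diagram_inverse:
  assumes "(T1, T2, \<sigma>) \<in> tree_diagrams n"
  shows "\<exists>\<tau>. (T2, T1, \<tau>) \<in> tree_diagrams n \<and> diagram_rel n (T2, T1, \<tau>) = (diagram_rel n (T1, T2, \<sigma>))\<inverse>"
proof -
  note D = tree_diagramD[OF assms]
  define \<tau> where "\<tau> = restrict (inv_into (leaves T1) \<sigma>) (leaves T2)"
  have "bij_betw (inv_into (leaves T1) \<sigma>) (leaves T2) (leaves T1)" using D(6) by (rule bij_betw_inv_into)
  then have "bij_betw \<tau> (leaves T2) (leaves T1)"
    by (rule bij_betw_cong[THEN iffD1, rotated]) (simp add: \<tau>_def)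
  then have T: "(T2, T1, \<tau>) \<in> tree_diagrams n" using D by (intro tree_diagramI) (simp_all add: \<tau>_def)
  have "diagram_rel n (T2, T1, \<tau>) \<subseteq> (diagram_rel n (T1, T2, \<sigma>))\<inverse>"
    unfolding diagram_rel_def prod.case
  proof (rule code_rel_subsetI)
    fix k assume k: "k \<in> leaves T2"
    then have "k \<in> \<sigma> ` leaves T1" using D(6) by (simp add: bij_betw_def)
    then obtain l where l: "l \<in> leaves T1" "\<sigma> l = k" by blast
    then have "\<tau> k = l" using D(6) k by (auto simp: \<tau>_def bij_betw_def)
    then show "maps_cone n ((code_rel n (leaves T1) \<sigma>)\<inverse>) k (\<tau> k)"
      using maps_cone_converse[OF maps_cone_code_rel[OF l(1), of n \<sigma>]] l(2) by simp
  qed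
  then show ?thesis
    using T bij_rel_eqI[OF bij_rel_diagram_rel[OF T] bij_rel_converse[OF bij_rel_diagram_rel[OF assms]]] by blast
qed

lemma diagram_comp:
  assumes "(T1, T, \<sigma>) \<in> tree_diagrams n" "(T, T2, \<tau>) \<in> tree_diagrams n"
  shows "(T1, T2, compose (leaves T1) \<tau> \<sigma>) \<in> tree_diagrams n"
    and "diagram_rel n (T1, T2, compose (leaves T1) \<tau> \<sigma>) = diagram_rel n (T1, T, \<sigma>) O diagram_rel n (T, T2, \<tau>)"
proof -
  note D = tree_diagramD[OF assms(1)] and E = tree_diagramD[OF assms(2)]
  have eq: "compose (leaves T1) \<tau> \<sigma> l = (\<tau> \<circ> \<sigma>) l" if "l \<in> leaves T1" for l using that by (simp add: compose_eq)
  have "bij_betw (\<tau> \<circ> \<sigma>) (leaves T1) (leaves T2)" using bij_betw_trans[OF D(6) E(6)] .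
  then have "bij_betw (compose (leaves T1) \<tau> \<sigma>) (leaves T1) (leaves T2)"
    by (rule bij_betw_cong[THEN iffD1, rotated]) (simp add: eq)
  then show "(T1, T2, compose (leaves T1) \<tau> \<sigma>) \<in> tree_diagrams n"
    using D E by (intro tree_diagramI) (simp_all add: compose_def)
  show "diagram_rel n (T1, T2, compose (leaves T1) \<tau> \<sigma>) = diagram_rel n (T1, T, \<sigma>) O diagram_rel n (T, T2, \<tau>)"
    unfolding diagram_rel_def prod.case code_rel_comp[OF D(3) E(3,4) D(6) E(6)]
    by (rule code_rel_cong) (rule eq)
qed

section \<open>The Higman--Thompson group as a group of permutations\<close>

context
  fixes n :: nat and x :: "nat \<Rightarrow> 'v"
  assumes n2: "n \<ge> 2" and inj: "inj_on x {1..2 * n - 1}"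
begin

text \<open>A longer word is a word of length \<open>N0\<close> with a tail, and the tail is carried
  along. Having all large \<open>N\<close> lets two permutations share one.\<close>

lemma realizes_maps_words:
  assumes "g \<in> end_perms n x"
  shows "\<exists>N0. \<forall>N\<ge>N0. \<forall>p\<in>words n N. \<exists>q\<in>lists {1..n}. maps_cone n g p q"
proof -
  obtain N0 where N0: "\<And>p. p \<in> lists {1..n} \<Longrightarrow> length p = N0 \<Longrightarrow> \<exists>q\<in>lists {1..n}. maps_cone n g p q"
    using realizes_maps_cones[OF n2 inj] assms by blast
  have "\<exists>q\<in>lists {1..n}. maps_cone n g p q" if p: "p \<in> words n N" "N \<ge> N0" for N p
  proof -
    have p': "take N0 p \<in> lists {1..n}" "drop N0 p \<in> lists {1..n}" "length (take N0 p) = N0"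
      using p by (auto dest: in_set_takeD in_set_dropD)
    then obtain q where "q \<in> lists {1..n}" "maps_cone n g (take N0 p) q" using N0 by blast
    then show ?thesis using maps_cone_append[of n g "take N0 p" q "drop N0 p"] p'
      by (intro bexI[of _ "q @ drop N0 p"]) auto
  qed
  then show ?thesis by blast
qed

lemma diagram_rel_image: "diagram_rel n ` tree_diagrams n = end_perms n x"
proof (intro equalityI subsetI)
  fix g assume "g \<in> diagram_rel n ` tree_diagrams n"
  then obtain T1 T2 \<sigma> where d: "(T1, T2, \<sigma>) \<in> tree_diagrams n" "g = diagram_rel n (T1, T2, \<sigma>)" by auto
  then show "g \<in> end_perms n x"
    using code_rel_in_end_perms[OF n2 inj tree_diagramD(3,4,6)[OF d(1)]] unfolding diagram_rel_def by simp
next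
  fix g assume g: "g \<in> end_perms n x"
  then obtain N where "\<forall>p\<in>words n N. \<exists>q\<in>lists {1..n}. maps_cone n g p q" using realizes_maps_words by blast
  then show "g \<in> diagram_rel n ` tree_diagrams n"
    using diagram_of_bij_rel[OF n2 end_perms_bij_rel[OF n2 inj g]] by blast
qed

text \<open>The middle tree is a complete tree deep enough to be the source for both
  \<open>g\<inverse>\<close> and \<open>h\<close>; inverting the first diagram makes it the target
  for \<open>g\<close>. This shows that the union defining a product is not empty.\<close>

lemma matching_diagrams:
  assumes "g \<in> end_perms n x" "h \<in> end_perms n x"
  shows "\<exists>T1 T T2 \<sigma> \<tau>. (T1, T, \<sigma>) \<in> tree_diagrams n \<and> (T, T2, \<tau>) \<in> tree_diagrams n \<and>
    diagram_rel n (T1, T, \<sigma>) = g \<and> diagram_rel n (T, T2, \<tau>) = h"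
proof -
  note g' = end_perms_converse[OF n2 inj assms(1)]
  obtain N1 where N1: "\<forall>N\<ge>N1. \<forall>p\<in>words n N. \<exists>q\<in>lists {1..n}. maps_cone n (g\<inverse>) p q"
    using realizes_maps_words[OF g'] by blast
  obtain N2 where N2: "\<forall>N\<ge>N2. \<forall>p\<in>words n N. \<exists>q\<in>lists {1..n}. maps_cone n h p q"
    using realizes_maps_words[OF assms(2)] by blast
  define N where "N = max N1 N2"
  have "\<forall>p\<in>words n N. \<exists>q\<in>lists {1..n}. maps_cone n (g\<inverse>) p q" using N1 unfolding N_def by (meson max.cobounded1)
  then obtain S S1 \<rho> where S: "(S, S1, \<rho>) \<in> tree_diagrams n" "leaves S = words n N" "diagram_rel n (S, S1, \<rho>) = g\<inverse>"
    using diagram_of_bij_rel[OF n2 end_perms_bij_rel[OF n2 inj g']] by blast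
  have "\<forall>p\<in>words n N. \<exists>q\<in>lists {1..n}. maps_cone n h p q" using N2 unfolding N_def by (meson max.cobounded2)
  then obtain R R2 \<tau> where R: "(R, R2, \<tau>) \<in> tree_diagrams n" "leaves R = words n N" "diagram_rel n (R, R2, \<tau>) = h"
    using diagram_of_bij_rel[OF n2 end_perms_bij_rel[OF n2 inj assms(2)]] by blast
  have "R = S" using leaves_inj[OF tree_diagramD(1)[OF R(1)] tree_diagramD(1)[OF S(1)]] R(2) S(2) by simp
  moreover obtain \<sigma> where "(S1, S, \<sigma>) \<in> tree_diagrams n" "diagram_rel n (S1, S, \<sigma>) = g"
    using diagram_inverse[OF S(1)] S(3) by auto
  ultimately show ?thesis using R by blast
qed

lemma group_Higman_Thompson: "group (Higman_Thompson n)" "end_group n x \<cong> Higman_Thompson n"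
proof -
  let ?D = "tree_diagrams n" and ?K = "diagram_rel n"
  have KS: "?K ` ?D = carrier (end_group n x)"
    using diagram_rel_image by (simp add: end_group_def)
  have cls: "diagram_equiv n `` {d} = {a \<in> ?D. ?K a = ?K d}" if "d \<in> ?D" for d
    using that unfolding diagram_equiv_iff[OF n2] by auto
  have car: "carrier (Higman_Thompson n) = (\<lambda>h. {a \<in> ?D. ?K a = h}) ` carrier (end_group n x)"
  proof -
    have "carrier (Higman_Thompson n) = (\<lambda>d. diagram_equiv n `` {d}) ` ?D"
      by (auto simp: Higman_Thompson_def quotient_def)
    also have "\<dots> = (\<lambda>d. {a \<in> ?D. ?K a = ?K d}) ` ?D" using cls by (rule image_cong[OF HOL.refl])
    finally show ?thesis unfolding KS[symmetric] image_image .
  qed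
  have "(Leaf, Leaf, \<lambda>v\<in>leaves Leaf. v) \<in> ?D"
    by (intro tree_diagramI nary_trees.Leaf) (simp_all add: bij_betw_def)
  moreover have "?K (Leaf, Leaf, \<lambda>v\<in>leaves Leaf. v) = Id_on (ends n)"
    by (auto simp: diagram_rel_def code_rel_def)
  ultimately have one: "one (Higman_Thompson n) = {a \<in> ?D. ?K a = \<one>\<^bsub>end_group n x\<^esub>}"
    using cls[of "(Leaf, Leaf, \<lambda>v\<in>leaves Leaf. v)"] by (simp add: Higman_Thompson_def end_group_def)
  have mult: "{a \<in> ?D. ?K a = h} \<otimes>\<^bsub>Higman_Thompson n\<^esub> {a \<in> ?D. ?K a = k} = {a \<in> ?D. ?K a = h \<otimes>\<^bsub>end_group n x\<^esub> k}"
    if hk: "h \<in> carrier (end_group n x)" "k \<in> carrier (end_group n x)" for h k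
  proof -
    let ?F = "{diagram_equiv n `` {(T1, T2, compose (leaves T1) \<sigma>' \<sigma>)} | T1 T T2 \<sigma> \<sigma>'.
      (T1, T, \<sigma>) \<in> {a \<in> ?D. ?K a = h} \<and> (T, T2, \<sigma>') \<in> {a \<in> ?D. ?K a = k}}"
    \<comment> \<open>Every matching pair of representatives yields the same fibre, so the union
      over the nonempty family \<open>?F\<close> is that fibre.\<close>
    have all: "Y = {a \<in> ?D. ?K a = h O k}" if Y: "Y \<in> ?F" for Y
    proof -
      obtain T1 T T2 \<sigma> \<sigma>' where *: "Y = diagram_equiv n `` {(T1, T2, compose (leaves T1) \<sigma>' \<sigma>)}"
        "(T1, T, \<sigma>) \<in> ?D" "?K (T1, T, \<sigma>) = h" "(T, T2, \<sigma>') \<in> ?D" "?K (T, T2, \<sigma>') = k" using Y by blast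
      show ?thesis unfolding *(1) cls[OF diagram_comp(1)[OF *(2,4)]] diagram_comp(2)[OF *(2,4)] *(3,5) ..
    qed
    have "?F \<noteq> {}"
    proof -
      obtain T1 T T2 \<sigma> \<tau> where "(T1, T, \<sigma>) \<in> ?D" "(T, T2, \<tau>) \<in> ?D" "?K (T1, T, \<sigma>) = h" "?K (T, T2, \<tau>) = k"
        using matching_diagrams[of h k] hk unfolding end_group_def by auto
      then have "diagram_equiv n `` {(T1, T2, compose (leaves T1) \<tau> \<sigma>)} \<in> ?F" by blast
      then show ?thesis by blast
    qed
    then have "\<Union>?F = {a \<in> ?D. ?K a = h O k}" using all by blast
    then show ?thesis by (simp add: Higman_Thompson_def end_group_def)
  qed
  show "group (Higman_Thompson n)" "end_group n x \<cong> Higman_Thompson n"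
    using group_iso_of_fibres[OF group_end_group[OF n2 inj] KS car one mult] by simp_all
qed

end

theorem theorem4p11:
  fixes n :: nat and x :: "nat \<Rightarrow> 'v"
  assumes "n \<ge> 2" and "inj_on x {1..2 * n - 1}"
  shows "group (Struct_G n x) \<and> group (Higman_Thompson n) \<and> Struct_G n x \<cong> Higman_Thompson n"
  using group_Struct_G[OF assms] group_Higman_Thompson[OF assms] group.iso_sym[OF group_end_group[OF assms]] iso_trans
  by blast

end
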